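(* Let $n\ge 1$, $0<q<\infty$, and let $g$ be a non-constant holomorphic function on $\mathbb{B}_n$. Then the optimal domain $[g:H^q]$, equipped with $\|f\|_{[g:H^q]}=\|T_gf\|_{H^q}$, is a quasi-Banach space (that is, a complete quasinormed space). If moreover $q\geq 1$, then it is a Banach space.
   Context: $\mathbb{B}_n=\{z\in\mathbb{C}^n:|z|<1\}$ is the open unit ball, $\mathbb{S}_n=\partial\mathbb{B}_n$ the unit sphere, $d\sigma$ the normalized surface measure on $\mathbb{S}_n$, and $H(\mathbb{B}_n)$ the space of holomorphic functions on $\mathbb{B}_n$. The radial derivative is $Rf(z)=\sum_{k=1}^n z_k\partial_{z_k}f(z)$. For $0<q<\infty$, the Hardy space $H^q$ consists of $f\in H(\mathbb{B}_n)$ with $\|f\|_{H^q}=\sup_{0\le s<1}\left(\int_{\mathbb{S}_n}|f(s\zeta)|^q\,d\sigma(\zeta)\right)^{1/q}<\infty$. For $g\in H(\mathbb{B}_n)$ the (generalized) Volterra integration operator on $H(\mathbb{B}_n)$ is $T_gf(z)=\int_0^1 f(tz)\,Rg(tz)\,\frac{dt}{t}$. The optimal domain is $[g:H^q]=\{f\in H(\mathbb{B}_n): T_gf\in H^q\}$. *)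

theory Defs
  imports "HOL-Analysis.Analysis"
begin

text \<open>
  Holomorphy in several complex variables, on open sets: the real Frechet derivative exists and is
  complex linear at every point.
\<close>

definition holomorphic_several_on ::
    "(complex ^ 'n::finite \<Rightarrow> complex) \<Rightarrow> (complex ^ 'n) set \<Rightarrow> bool" where
  "holomorphic_several_on f S \<longleftrightarrow>
     (\<forall>z\<in>S. \<exists>D. (f has_derivative D) (at z) \<and> (\<forall>c v. D (c *s v) = c * D v))"

text \<open>
  A function on the open unit ball is represented by its extension by zero to the whole space,
  so that equality in HOL is equality on the ball.
\<close>

definition ball_holomorphic :: "(complex ^ 'n::finite \<Rightarrow> complex) set" where
  "ball_holomorphic =
     {f. holomorphic_several_on f (ball 0 1) \<and> (\<forall>z. z \<notin> ball 0 1 \<longrightarrow> f z = 0)}"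

definition partial_deriv ::
    "'n::finite \<Rightarrow> (complex ^ 'n \<Rightarrow> complex) \<Rightarrow> complex ^ 'n \<Rightarrow> complex" where
  "partial_deriv k f z = deriv (\<lambda>w. f (\<chi> j. if j = k then w else z $ j)) (z $ k)"

definition radial_deriv ::
    "(complex ^ 'n::finite \<Rightarrow> complex) \<Rightarrow> complex ^ 'n \<Rightarrow> complex" where
  "radial_deriv f z = (\<Sum>k\<in>UNIV. z $ k * partial_deriv k f z)"

text \<open>
  Normalized surface measure on the unit sphere, defined by polar coordinates: the measure of a
  Borel set \<open>E\<close> in the sphere is the proportion of the volume of the unit ball that
  lies in the cone \<open>{r x | 0 < r < 1, x \<in> E}\<close>. Note that \<open>sgn x\<close> is \<open>x\<close> divided by its norm.
\<close>

definition sphere_measure :: "'a::euclidean_space measure" where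
  "sphere_measure =
     restrict_space (distr (uniform_measure lborel (ball 0 1)) borel sgn) (sphere 0 1)"

lemma space_sphere_measure: "space sphere_measure = (sphere 0 1 :: 'a::euclidean_space set)"
  by (simp add: sphere_measure_def space_restrict_space)

lemma emeasure_sphere_measure:
  fixes E :: "'a::euclidean_space set"
  assumes "E \<in> sets borel" "E \<subseteq> sphere 0 1"
  shows "emeasure sphere_measure E =
    emeasure lborel {x \<in> ball 0 1. sgn x \<in> E} / emeasure lborel (ball (0::'a) 1)"
proof -
  have m: "sgn -` E \<in> sets (borel :: 'a measure)"
    using measurable_sets[OF borel_measurable_sgn assms(1)] by simp
  have "emeasure sphere_measure E =
      emeasure (distr (uniform_measure lborel (ball (0::'a) 1)) borel sgn) E"
    unfolding sphere_measure_def by (rule emeasure_restrict_space) (use assms in auto)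
  also have "\<dots> = emeasure (uniform_measure lborel (ball (0::'a) 1)) (sgn -` E)"
    using assms(1) by (subst emeasure_distr) auto
  also have "\<dots> = emeasure lborel (ball (0::'a) 1 \<inter> sgn -` E) / emeasure lborel (ball (0::'a) 1)"
    using m by simp
  also have "ball (0::'a) 1 \<inter> sgn -` E = {x \<in> ball 0 1. sgn x \<in> E}"
    by auto
  finally show ?thesis .
qed

lemma emeasure_sphere_measure_total: "emeasure sphere_measure (sphere (0::'a::euclidean_space) 1) = 1"
proof -
  have "{x \<in> ball (0::'a) 1. sgn x \<in> sphere 0 1} = ball 0 1 - {0}"
    by (auto simp: norm_sgn)
  moreover have "emeasure lborel (ball (0::'a) 1 - {0}) = emeasure lborel (ball (0::'a) 1)"
    by (subst emeasure_Diff) auto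
  moreover have "emeasure lborel (ball (0::'a) 1) \<noteq> 0" "emeasure lborel (ball (0::'a) 1) \<noteq> \<infinity>"
    using emeasure_lborel_ball_finite[of "0::'a" 1] open_not_negligible[of "ball (0::'a) 1"]
    by (auto simp: negligible_iff_emeasure0 emeasure_completion)
  ultimately show ?thesis
    by (simp add: emeasure_sphere_measure ennreal_divide_self less_top del: mem_ball mem_sphere)
qed

definition hardy_mean ::
    "real \<Rightarrow> (complex ^ 'n::finite \<Rightarrow> complex) \<Rightarrow> real \<Rightarrow> real" where
  "hardy_mean q f s = (LINT \<zeta>|sphere_measure. norm (f (s *\<^sub>R \<zeta>)) powr q) powr (1 / q)"

text \<open>
  For holomorphic \<open>f\<close> every mean is the integral of a bounded continuous function, so boundedness
  of the means is the only finiteness condition.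
\<close>

definition hardy_space :: "real \<Rightarrow> (complex ^ 'n::finite \<Rightarrow> complex) set" where
  "hardy_space q = {f \<in> ball_holomorphic. bdd_above (hardy_mean q f ` {0..<1})}"

definition hardy_norm :: "real \<Rightarrow> (complex ^ 'n::finite \<Rightarrow> complex) \<Rightarrow> real" where
  "hardy_norm q f = (SUP s\<in>{0..<1}. hardy_mean q f s)"

definition volterra ::
    "(complex ^ 'n::finite \<Rightarrow> complex) \<Rightarrow> (complex ^ 'n \<Rightarrow> complex) \<Rightarrow> complex ^ 'n \<Rightarrow> complex" where
  "volterra g f z =
     (if z \<in> ball 0 1
      then integral {0..1} (\<lambda>t. f (t *\<^sub>R z) * radial_deriv g (t *\<^sub>R z) / of_real t)
      else 0)"

definition optimal_domain ::
    "(complex ^ 'n::finite \<Rightarrow> complex) \<Rightarrow> real \<Rightarrow> (complex ^ 'n \<Rightarrow> complex) set" where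
  "optimal_domain g q = {f \<in> ball_holomorphic. volterra g f \<in> hardy_space q}"

definition optimal_norm ::
    "(complex ^ 'n::finite \<Rightarrow> complex) \<Rightarrow> real \<Rightarrow> (complex ^ 'n \<Rightarrow> complex) \<Rightarrow> real" where
  "optimal_norm g q f = hardy_norm q (volterra g f)"

definition function_subspace :: "('a \<Rightarrow> complex) set \<Rightarrow> bool" where
  "function_subspace V \<longleftrightarrow>
     (\<lambda>x. 0) \<in> V \<and>
     (\<forall>f\<in>V. \<forall>h\<in>V. (\<lambda>x. f x + h x) \<in> V) \<and>
     (\<forall>c. \<forall>f\<in>V. (\<lambda>x. c * f x) \<in> V)"

definition quasinorm_with_constant ::
    "real \<Rightarrow> ('a \<Rightarrow> complex) set \<Rightarrow> (('a \<Rightarrow> complex) \<Rightarrow> real) \<Rightarrow> bool" where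
  "quasinorm_with_constant K V N \<longleftrightarrow>
     (\<forall>f\<in>V. 0 \<le> N f) \<and>
     (\<forall>f\<in>V. N f = 0 \<longleftrightarrow> f = (\<lambda>x. 0)) \<and>
     (\<forall>c. \<forall>f\<in>V. N (\<lambda>x. c * f x) = norm c * N f) \<and>
     (\<forall>f\<in>V. \<forall>h\<in>V. N (\<lambda>x. f x + h x) \<le> K * (N f + N h))"

definition quasinormed_complete ::
    "('a \<Rightarrow> complex) set \<Rightarrow> (('a \<Rightarrow> complex) \<Rightarrow> real) \<Rightarrow> bool" where
  "quasinormed_complete V N \<longleftrightarrow>
     (\<forall>F :: nat \<Rightarrow> 'a \<Rightarrow> complex.
        (\<forall>k. F k \<in> V) \<and>
        (\<forall>e>0. \<exists>M. \<forall>m\<ge>M. \<forall>n\<ge>M. N (\<lambda>x. F m x - F n x) < e) \<longrightarrow>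
        (\<exists>f\<in>V. (\<lambda>k. N (\<lambda>x. F k x - f x)) \<longlonglongrightarrow> 0))"

definition quasi_banach_space ::
    "('a \<Rightarrow> complex) set \<Rightarrow> (('a \<Rightarrow> complex) \<Rightarrow> real) \<Rightarrow> bool" where
  "quasi_banach_space V N \<longleftrightarrow>
     function_subspace V \<and> (\<exists>K\<ge>1. quasinorm_with_constant K V N) \<and> quasinormed_complete V N"

definition banach_space ::
    "('a \<Rightarrow> complex) set \<Rightarrow> (('a \<Rightarrow> complex) \<Rightarrow> real) \<Rightarrow> bool" where
  "banach_space V N \<longleftrightarrow>
     function_subspace V \<and> quasinorm_with_constant 1 V N \<and> quasinormed_complete V N"

end

theory Submission
  imports Defs "HOL-Complex_Analysis.Complex_Analysis"
begin

text \<open>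
  Write \<open>T f\<close> for the Volterra operator and \<open>R\<close> for the radial derivative. Along complex rays \<open>T f\<close> is a
  primitive, so that \<open>R (T f) = f * R g\<close>. Point evaluations are bounded on the Hardy space, locally
  uniformly, also for \<open>q < 1\<close>. Hence \<open>T f = 0\<close> forces \<open>f * R g = 0\<close> and \<open>f = 0\<close>, as \<open>R g\<close> does not vanish
  identically. For a Cauchy sequence \<open>F\<close>, the functions \<open>T (F k)\<close> and, by Cauchy's estimates, also
  \<open>F k * R g\<close> converge locally uniformly. Dividing by \<open>R g\<close> with the help of the maximum principle on
  small circles that avoid its zeros, one gets a locally uniform limit of \<open>F\<close> itself.
\<close>

subsection \<open>Slices of holomorphic functions of several variables\<close>

text \<open>Joint holomorphy of \<open>volterra g f\<close> is never derived for arbitrary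
  \<open>f\<close>: membership in \<open>hardy_space\<close> contains it, and the limit needed for
  completeness has it as a locally uniform limit. So the operator itself is studied only on complex
  lines through the origin, by one-variable primitives. For \<open>R g\<close> joint holomorphy is
  indispensable, because the division takes place on lines through arbitrary points of the ball. It
  comes from writing \<open>R g\<close> as a locally uniform limit of difference quotients of
  dilations of \<open>g\<close>. Two obstacles shape the completeness proof. The norm controls only
  \<open>T f\<close>, so bounds on \<open>f\<close> must be carried across the zeros of
  \<open>R g\<close>, uniformly in \<open>f\<close>. And locally uniform convergence says nothing
  about the supremum over all radii: convergence in norm needs a separate argument, on each sphere
  alone but with an index that does not depend on the radius.\<close>

lemma norm_vector_smult: "norm (c *s v) = norm c * norm (v :: complex ^ 'n::finite)"
  by (simp add: norm_vec_def vector_scalar_mult_def norm_mult L2_set_right_distrib)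

lemma scaleR_eq_vector_smult: "r *\<^sub>R v = of_real r *s (v :: complex ^ 'n::finite)"
  by (simp add: vec_eq_iff scaleR_conv_of_real[where 'a=complex])

lemma bounded_linear_vector_smult_left: "bounded_linear (\<lambda>c. c *s (v :: complex ^ 'n::finite))"
  by (rule bounded_linear_intro[where K = "norm v"])
     (auto simp: vec_eq_iff norm_vector_smult algebra_simps)

lemma bounded_linear_vector_smult_right: "bounded_linear (\<lambda>v. c *s (v :: complex ^ 'n::finite))"
  by (rule bounded_linear_intro[where K = "norm c"])
     (auto simp: vec_eq_iff norm_vector_smult algebra_simps)

lemmas continuous_on_vector_smult_left [continuous_intros] =
  bounded_linear.continuous_on[OF bounded_linear_vector_smult_left]

lemma open_slice:
  fixes a v :: "complex ^ 'n::finite"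
  assumes "open S"
  shows "open {l. a + l *s v \<in> S}"
proof -
  have "open ((\<lambda>l. a + l *s v) -` S)"
    by (intro open_vimage assms continuous_intros)
  then show ?thesis by (simp add: vimage_def)
qed

text \<open>Convexity of the parameter sets serves twice: a holomorphic function on such a set has a
  primitive, and connectedness allows the identity theorem on a complex line.\<close>

lemma convex_slice:
  fixes a v :: "complex ^ 'n::finite"
  assumes "convex S"
  shows "convex {l. a + l *s v \<in> S}"
proof (rule convexI, unfold mem_Collect_eq)
  fix x y :: complex and u w :: real
  assume *: "a + x *s v \<in> S" "a + y *s v \<in> S" "0 \<le> u" "0 \<le> w" "u + w = 1"
  have "a = u *\<^sub>R a + w *\<^sub>R a"
    using *(5) by (simp flip: scaleR_left_distrib)
  then have "a + (u *\<^sub>R x + w *\<^sub>R y) *s v = u *\<^sub>R (a + x *s v) + w *\<^sub>R (a + y *s v)"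
    by (simp add: vec_eq_iff algebra_simps)
  then show "a + (u *\<^sub>R x + w *\<^sub>R y) *s v \<in> S"
    using convexD[OF assms *] by simp
qed

text \<open>Complex homogeneity of \<open>D\<close> turns the real derivative
  \<open>\<lambda>l. D (l *s v)\<close> of the slice into multiplication by the number
  \<open>D v\<close>, which is what a complex derivative is.\<close>

lemma has_field_derivative_slice:
  fixes a v :: "complex ^ 'n::finite"
  assumes "(f has_derivative D) (at (a + l *s v))" and "\<And>c v. D (c *s v) = c * D v"
  shows "((\<lambda>l. f (a + l *s v)) has_field_derivative D v) (at l)"
proof -
  have "((\<lambda>l. a + l *s v) has_derivative (\<lambda>l. l *s v)) (at l)"
    by (rule derivative_eq_intros bounded_linear.has_derivative[OF bounded_linear_vector_smult_left] refl)+ simp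
  from has_derivative_compose[OF this assms(1)]
  have "((\<lambda>l. f (a + l *s v)) has_derivative (\<lambda>l. l * D v)) (at l)"
    by (simp add: assms(2))
  then show ?thesis
    by (rule has_derivative_imp_has_field_derivative) simp
qed

lemma holomorphic_several_onE:
  assumes "holomorphic_several_on f S" "z \<in> S"
  obtains D where "(f has_derivative D) (at z)" "\<And>c v. D (c *s v) = c * D v"
  using assms by (auto simp: holomorphic_several_on_def)

lemma holomorphic_several_on_subset:
  "holomorphic_several_on f S \<Longrightarrow> T \<subseteq> S \<Longrightarrow> holomorphic_several_on f T"
  by (auto simp: holomorphic_several_on_def)

lemma holomorphic_several_on_imp_continuous_on:
  "holomorphic_several_on f S \<Longrightarrow> continuous_on S f"
  by (intro continuous_at_imp_continuous_on ballI)
     (auto elim!: holomorphic_several_onE intro: has_derivative_continuous)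

lemma holomorphic_on_slice:
  fixes a v :: "complex ^ 'n::finite"
  assumes "holomorphic_several_on f S"
  shows "(\<lambda>l. f (a + l *s v)) holomorphic_on {l. a + l *s v \<in> S}"
  unfolding holomorphic_on_def field_differentiable_def
proof clarify
  fix l assume "a + l *s v \<in> S"
  with assms obtain D where D: "(f has_derivative D) (at (a + l *s v))" "\<And>c v. D (c *s v) = c * D v"
    by (auto elim: holomorphic_several_onE)
  from has_field_derivative_slice[OF D]
  show "\<exists>f'. ((\<lambda>l. f (a + l *s v)) has_field_derivative f') (at l within {l. a + l *s v \<in> S})"
    by (blast intro: has_field_derivative_at_within)
qed

lemma holomorphic_on_ray:
  assumes "holomorphic_several_on f S"
  shows "(\<lambda>l. f (l *s z)) holomorphic_on {l. l *s z \<in> S}"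
  using holomorphic_on_slice[OF assms, of 0 z] by simp

lemma holomorphic_several_on_add:
  assumes "holomorphic_several_on f S" "holomorphic_several_on h S"
  shows "holomorphic_several_on (\<lambda>x. f x + h x) S"
  unfolding holomorphic_several_on_def
proof
  fix z assume z: "z \<in> S"
  from z obtain D where D: "(f has_derivative D) (at z)" "\<And>c v. D (c *s v) = c * D v"
    using assms(1) by (auto elim: holomorphic_several_onE)
  from z obtain E where E: "(h has_derivative E) (at z)" "\<And>c v. E (c *s v) = c * E v"
    using assms(2) by (auto elim: holomorphic_several_onE)
  show "\<exists>D. ((\<lambda>x. f x + h x) has_derivative D) (at z) \<and> (\<forall>c v. D (c *s v) = c * D v)"
    by (intro exI[of _ "\<lambda>v. D v + E v"] conjI has_derivative_add D E)
       (simp add: D E algebra_simps)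
qed

lemma holomorphic_several_on_cmult:
  assumes "holomorphic_several_on f S"
  shows "holomorphic_several_on (\<lambda>x. c * f x) S"
  unfolding holomorphic_several_on_def
proof
  fix z assume z: "z \<in> S"
  from z obtain D where D: "(f has_derivative D) (at z)" "\<And>c v. D (c *s v) = c * D v"
    using assms(1) by (auto elim: holomorphic_several_onE)
  show "\<exists>D. ((\<lambda>x. c * f x) has_derivative D) (at z) \<and> (\<forall>c v. D (c *s v) = c * D v)"
    by (intro exI[of _ "\<lambda>v. c * D v"] conjI has_derivative_mult_right D)
       (simp add: D algebra_simps)
qed

lemma holomorphic_several_on_diff:
  assumes "holomorphic_several_on f S" "holomorphic_several_on h S"
  shows "holomorphic_several_on (\<lambda>x. f x - h x) S"
  using holomorphic_several_on_add[OF assms(1) holomorphic_several_on_cmult[OF assms(2), of "-1"]]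
  by simp

lemma holomorphic_several_on_dilation:
  assumes "holomorphic_several_on f T" "\<And>z. z \<in> S \<Longrightarrow> c *s z \<in> T"
  shows "holomorphic_several_on (\<lambda>z. f (c *s z)) S"
  unfolding holomorphic_several_on_def
proof
  fix z assume z: "z \<in> S"
  from assms(2)[OF z] obtain D where D: "(f has_derivative D) (at (c *s z))" "\<And>c v. D (c *s v) = c * D v"
    using assms(1) by (auto elim: holomorphic_several_onE)
  have "((\<lambda>z. f (c *s z)) has_derivative (\<lambda>v. D (c *s v))) (at z)"
    using has_derivative_compose[of "\<lambda>z. c *s z" "\<lambda>v. c *s v" z UNIV f D] D(1)
    by (simp add: bounded_linear_imp_has_derivative bounded_linear_vector_smult_right)
  then show "\<exists>D. ((\<lambda>z. f (c *s z)) has_derivative D) (at z) \<and> (\<forall>c v. D (c *s v) = c * D v)"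
    by (intro exI[of _ "\<lambda>v. D (c *s v)"] conjI) (auto simp: D)
qed

text \<open>Each partial derivative is the derivative of a slice in a coordinate direction;
  expanding \<open>z\<close> in the standard basis and using linearity of \<open>D\<close> removes
  the coordinates.\<close>

lemma radial_deriv_eq:
  fixes z :: "complex ^ 'n::finite"
  assumes D: "(f has_derivative D) (at z)" "\<And>c v. D (c *s v) = c * D v"
  shows "radial_deriv f z = D z"
proof -
  interpret D: bounded_linear D using D(1) by (rule has_derivative_bounded_linear)
  have pd: "partial_deriv k f z = D (axis k 1)" for k
  proof -
    have eq: "(\<chi> j. if j = k then w else z $ j) = (z - (z $ k) *s axis k 1) + w *s axis k 1" for w
      by (auto simp: vec_eq_iff axis_def)
    have "((\<lambda>w. f ((z - (z $ k) *s axis k 1) + w *s axis k 1)) has_field_derivative D (axis k 1)) (at (z $ k))"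
      by (rule has_field_derivative_slice) (use D in auto)
    then show ?thesis
      unfolding partial_deriv_def eq by (rule DERIV_imp_deriv)
  qed
  have "D z = D (\<Sum>k\<in>UNIV. z $ k *s axis k 1)"
    by (simp add: basis_expansion)
  also have "\<dots> = (\<Sum>k\<in>UNIV. z $ k * D (axis k 1))"
    by (simp only: D.sum D(2))
  finally show ?thesis
    by (simp add: radial_deriv_def pd)
qed

text \<open>The factor \<open>l\<close> is the one that cancels the division by \<open>t\<close> in
  \<open>volterra\<close>.\<close>

lemma radial_deriv_ray:
  assumes "holomorphic_several_on f S" "l *s z \<in> S"
  shows "radial_deriv f (l *s z) = l * deriv (\<lambda>l. f (l *s z)) l"
proof -
  obtain D where D: "(f has_derivative D) (at (l *s z))" "\<And>c v. D (c *s v) = c * D v"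
    using assms by (auto elim: holomorphic_several_onE)
  have "((\<lambda>l. f (0 + l *s z)) has_field_derivative D z) (at l)"
    by (rule has_field_derivative_slice) (use D in auto)
  from DERIV_imp_deriv[OF this] show ?thesis
    by (simp add: radial_deriv_eq[OF D] D(2))
qed

subsection \<open>The Volterra operator on rays\<close>

lemma segment_in_unit_ball:
  fixes z :: "complex ^ 'n::finite"
  assumes "l *s z \<in> ball 0 1" "0 \<le> t" "t \<le> 1"
  shows "(of_real t * l) *s z \<in> ball 0 1"
proof -
  have "t * (norm l * norm z) \<le> 1 * (norm l * norm z)"
    using assms by (intro mult_right_mono) auto
  then show ?thesis
    using assms by (simp add: norm_vector_smult norm_mult mult.assoc)
qed

text \<open>The radial derivative of \<open>g\<close> at \<open>t *\<^sub>R (l *s z)\<close> carries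
  the factor \<open>t * l\<close>. After division by \<open>t\<close> the integrand is the
  derivative of \<open>P (t * l)\<close> in \<open>t\<close>, so the fundamental theorem of calculus
  applies.\<close>

lemma volterra_has_integral:
  fixes z :: "complex ^ 'n::finite"
  assumes g: "holomorphic_several_on g (ball 0 1)"
    and P: "\<And>l. l *s z \<in> ball 0 1 \<Longrightarrow>
      (P has_field_derivative f (l *s z) * deriv (\<lambda>l. g (l *s z)) l) (at l)"
    and l: "l *s z \<in> ball 0 1"
  shows "((\<lambda>t. f (t *\<^sub>R (l *s z)) * radial_deriv g (t *\<^sub>R (l *s z)) / of_real t)
           has_integral (P l - P 0)) {0..1}"
proof -
  define k where "k = (\<lambda>l. f (l *s z) * deriv (\<lambda>l. g (l *s z)) l)"
  have "((\<lambda>t. k (of_real t * l) * l) has_integral (P (of_real 1 * l) - P (of_real 0 * l))) {0..1}"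
  proof (rule fundamental_theorem_of_calculus)
    fix t :: real assume t: "t \<in> {0..1}"
    have "(P has_field_derivative k (of_real t * l)) (at (of_real t * l))"
      unfolding k_def using t segment_in_unit_ball[OF l, of t] by (intro P) auto
    moreover have "((\<lambda>t. of_real t * l) has_vector_derivative l) (at t within {0..1})"
      by (auto intro!: derivative_eq_intros)
    ultimately show "((\<lambda>t. P (of_real t * l)) has_vector_derivative k (of_real t * l) * l) (at t within {0..1})"
      using field_vector_diff_chain_within[of "\<lambda>t. of_real t * l" l t "{0..1}" P "k (of_real t * l)"]
      by (auto simp: o_def mult.commute intro: has_field_derivative_at_within)
  qed simp
  then have "((\<lambda>t. k (of_real t * l) * l) has_integral (P l - P 0)) {0..1}"
    by simp
  \<comment> \<open>At \<open>t = 0\<close> the integrand is 0 by the convention for division, while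
    \<open>k 0 * l\<close> may be nonzero. A single point does not affect the integral.\<close>
  then show ?thesis
  proof (rule has_integral_spike_finite[where S = "{0}", rotated 2])
    fix t :: real assume t: "t \<in> {0..1} - {0}"
    have "t *\<^sub>R (l *s z) = (of_real t * l) *s z"
      by (simp add: scaleR_eq_vector_smult vec_eq_iff)
    moreover have "radial_deriv g ((of_real t * l) *s z)
        = (of_real t * l) * deriv (\<lambda>l. g (l *s z)) (of_real t * l)"
      using t segment_in_unit_ball[OF l, of t] by (intro radial_deriv_ray[OF g]) auto
    ultimately show "f (t *\<^sub>R (l *s z)) * radial_deriv g (t *\<^sub>R (l *s z)) / of_real t
        = k (of_real t * l) * l"
      using t by (simp add: k_def)
  qed simp
qed

lemma volterra_ray_eq:
  fixes z :: "complex ^ 'n::finite"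
  assumes g: "holomorphic_several_on g (ball 0 1)"
    and P: "\<And>l. l *s z \<in> ball 0 1 \<Longrightarrow>
      (P has_field_derivative f (l *s z) * deriv (\<lambda>l. g (l *s z)) l) (at l)"
    and l: "l *s z \<in> ball 0 1"
  shows "volterra g f (l *s z) = P l - P 0"
  using integral_unique[OF volterra_has_integral[OF g P l]] l by (simp add: volterra_def)

lemma volterra_primitive_exists:
  fixes z :: "complex ^ 'n::finite"
  assumes f: "holomorphic_several_on f (ball 0 1)" and g: "holomorphic_several_on g (ball 0 1)"
  obtains P where "\<And>l. l *s z \<in> ball 0 1 \<Longrightarrow>
      (P has_field_derivative f (l *s z) * deriv (\<lambda>l. g (l *s z)) l) (at l)"
proof -
  define U where "U = {l. l *s z \<in> ball 0 1}"
  have U: "open U" "convex U"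
    using open_slice[of "ball 0 1" 0 z] convex_slice[of "ball 0 1" 0 z] by (auto simp: U_def)
  have "(\<lambda>l. f (l *s z) * deriv (\<lambda>l. g (l *s z)) l) holomorphic_on U"
    using holomorphic_on_ray[OF f, of z] holomorphic_on_ray[OF g, of z] U
    by (intro holomorphic_on_mult holomorphic_deriv) (auto simp: U_def)
  then obtain P where "\<And>l. l \<in> U \<Longrightarrow>
      (P has_field_derivative f (l *s z) * deriv (\<lambda>l. g (l *s z)) l) (at l within U)"
    using holomorphic_convex_primitive'[OF U(2,1)] by blast
  then show ?thesis
    using that[of P] at_within_open[OF _ U(1)] unfolding U_def by fastforce
qed

text \<open>Additivity of \<open>volterra\<close> rests on this, since \<open>integral\<close> has a
  default value on non-integrable functions. The primitive gives integrability without estimates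
  near \<open>t = 0\<close>.\<close>

lemma volterra_integrable:
  fixes z :: "complex ^ 'n::finite"
  assumes f: "holomorphic_several_on f (ball 0 1)" and g: "holomorphic_several_on g (ball 0 1)"
    and z: "z \<in> ball 0 1"
  shows "(\<lambda>t. f (t *\<^sub>R z) * radial_deriv g (t *\<^sub>R z) / of_real t) integrable_on {0..1}"
proof -
  obtain P where P: "\<And>l. l *s z \<in> ball 0 1 \<Longrightarrow>
      (P has_field_derivative f (l *s z) * deriv (\<lambda>l. g (l *s z)) l) (at l)"
    using volterra_primitive_exists[OF f g] by blast
  from volterra_has_integral[OF g P, of 1] z show ?thesis
    by (auto simp: integrable_on_def)
qed

lemma has_field_derivative_volterra_ray:
  fixes z :: "complex ^ 'n::finite"
  assumes f: "holomorphic_several_on f (ball 0 1)" and g: "holomorphic_several_on g (ball 0 1)"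
    and l: "l *s z \<in> ball 0 1"
  shows "((\<lambda>l. volterra g f (l *s z)) has_field_derivative
           f (l *s z) * deriv (\<lambda>l. g (l *s z)) l) (at l)"
proof -
  obtain P where P: "\<And>l. l *s z \<in> ball 0 1 \<Longrightarrow>
      (P has_field_derivative f (l *s z) * deriv (\<lambda>l. g (l *s z)) l) (at l)"
    using volterra_primitive_exists[OF f g] by blast
  have "((\<lambda>l. P l - P 0) has_field_derivative f (l *s z) * deriv (\<lambda>l. g (l *s z)) l) (at l)"
    using DERIV_diff[OF P[OF l] DERIV_const[of "P 0"]] by simp
  moreover have "open {l. l *s z \<in> ball 0 1}"
    using open_slice[of "ball 0 1" 0 z] by simp
  ultimately show ?thesis
    by (rule has_field_derivative_transform_within_open)
       (use l volterra_ray_eq[OF g P] in auto)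
qed

text \<open>The derivative along the ray through \<open>z\<close>, taken at \<open>l = 1\<close>.
  The hypothesis on \<open>volterra g f\<close> is what links this derivative to
  \<open>radial_deriv\<close>; elements of the optimal domain satisfy it by definition.\<close>

lemma radial_deriv_volterra:
  assumes f: "holomorphic_several_on f (ball 0 1)" and g: "holomorphic_several_on g (ball 0 1)"
    and h: "holomorphic_several_on (volterra g f) (ball 0 1)"
    and z: "z \<in> ball 0 1"
  shows "radial_deriv (volterra g f) z = f z * radial_deriv g z"
  using radial_deriv_ray[OF h, of 1 z] radial_deriv_ray[OF g, of 1 z] z
    DERIV_imp_deriv[OF has_field_derivative_volterra_ray[OF f g, of 1 z]]
  by simp

lemma volterra_add:
  assumes g: "holomorphic_several_on g (ball 0 1)"
    and "holomorphic_several_on f (ball 0 1)" "holomorphic_several_on h (ball 0 1)"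
  shows "volterra g (\<lambda>x. f x + h x) = (\<lambda>x. volterra g f x + volterra g h x)"
proof
  fix z
  show "volterra g (\<lambda>x. f x + h x) z = volterra g f z + volterra g h z"
    using integral_add[OF volterra_integrable[OF assms(2) g, of z] volterra_integrable[OF assms(3) g, of z]]
    by (simp add: volterra_def ring_distribs add_divide_distrib)
qed

lemma volterra_cmult: "volterra g (\<lambda>x. c * f x) = (\<lambda>x. c * volterra g f x)"
proof
  fix z
  show "volterra g (\<lambda>x. c * f x) z = c * volterra g f z"
    by (simp add: volterra_def mult.assoc flip: integral_mult_right times_divide_eq_right)
qed

lemma volterra_diff:
  assumes g: "holomorphic_several_on g (ball 0 1)"
    and f: "holomorphic_several_on f (ball 0 1)" and h: "holomorphic_several_on h (ball 0 1)"
  shows "volterra g (\<lambda>x. f x - h x) = (\<lambda>x. volterra g f x - volterra g h x)"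
  using volterra_add[OF g f holomorphic_several_on_cmult[OF h, of "-1"]]
  unfolding volterra_cmult by simp

text \<open>With the constant 1 in place of \<open>f\<close>, integration along the ray returns
  \<open>g z - g 0\<close>. If the radial derivative vanished identically, \<open>g\<close> would be
  constant.\<close>

lemma radial_deriv_nonzero_exists:
  assumes g: "holomorphic_several_on g (ball 0 1)" and nc: "\<not> g constant_on ball 0 1"
  obtains p where "p \<in> ball 0 1" "radial_deriv g p \<noteq> 0"
proof -
  have "g z = g 0" if 0: "\<And>p. p \<in> ball 0 1 \<Longrightarrow> radial_deriv g p = 0" and z: "z \<in> ball 0 1" for z
  proof -
    have "open {l. l *s z \<in> ball 0 1}"
      using open_slice[of "ball 0 1" 0 z] by simp
    with holomorphic_on_ray[OF g, of z]
    have P: "((\<lambda>l. g (l *s z)) has_field_derivative 1 * deriv (\<lambda>l. g (l *s z)) l) (at l)"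
      if "l *s z \<in> ball 0 1" for l
      using that by (simp add: holomorphic_derivI)
    have "((\<lambda>t. 1 * radial_deriv g (t *\<^sub>R (1 *s z)) / of_real t) has_integral (g (1 *s z) - g (0 *s z))) {0..1}"
      by (rule volterra_has_integral[OF g, of z "\<lambda>l. g (l *s z)" "\<lambda>x. 1"]) (use P z in auto)
    moreover have "((\<lambda>t. 1 * radial_deriv g (t *\<^sub>R (1 *s z)) / of_real t) has_integral 0) {0..1}"
    proof (rule has_integral_is_0)
      fix t :: real assume "t \<in> {0..1}"
      with z have "(of_real t * 1) *s z \<in> ball 0 1"
        by (intro segment_in_unit_ball) auto
      then show "1 * radial_deriv g (t *\<^sub>R (1 *s z)) / of_real t = 0"
        using 0 by (simp add: scaleR_eq_vector_smult)
    qed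
    ultimately have "g (1 *s z) - g (0 *s z) = 0"
      by (rule has_integral_unique)
    then show ?thesis by simp
  qed
  then show ?thesis
    using that nc unfolding constant_on_def by blast
qed

subsection \<open>Cauchy's estimates and locally uniform limits\<close>

lemma Cauchy_Taylor_bounds:
  assumes hol: "f holomorphic_on U" and U: "open U" "cball 0 r \<subseteq> U" and r: "0 < r"
    and M: "\<And>x. x \<in> cball 0 r \<Longrightarrow> norm (f x) \<le> M"
    and l: "norm l \<le> r / 2"
  shows "norm (f l - f 0) \<le> 2 * M / r * norm l"
    and "norm (f l - f 0 - deriv f 0 * l) \<le> 8 * M / r\<^sup>2 * (norm l)\<^sup>2"
proof -
  \<comment> \<open>Discs of radius \<open>r / 2\<close> about points of
    \<open>cball 0 (r / 2)\<close> stay inside \<open>cball 0 r\<close>. The cases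
    \<open>n = 1\<close> and \<open>n = 2\<close> yield the constants \<open>2 * M / r\<close> and
    \<open>8 * M / r\<^sup>2\<close>.\<close>
  have bd: "norm ((deriv ^^ n) f x) \<le> fact n * M / (r / 2) ^ n" if "x \<in> cball 0 (r / 2)" for n x
  proof (rule Cauchy_inequality)
    have "cball x (r / 2) \<subseteq> cball 0 r"
    proof
      fix y assume "y \<in> cball x (r / 2)"
      then show "y \<in> cball 0 r"
        using that norm_triangle_ineq[of x "y - x"] by (simp add: dist_norm norm_minus_commute)
    qed
    with U have sub: "cball x (r / 2) \<subseteq> U" by blast
    then show "continuous_on (cball x (r / 2)) f" "f holomorphic_on ball x (r / 2)"
      using hol ball_subset_cball[of x "r / 2"]
      by (meson holomorphic_on_imp_continuous_on holomorphic_on_subset order_trans)+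
    show "norm (f y) \<le> M" if "norm (x - y) = r / 2" for y
      using that \<open>cball x (r / 2) \<subseteq> cball 0 r\<close> by (intro M) (auto simp: dist_norm)
  qed (use r in auto)
  have der: "((deriv ^^ i) f has_field_derivative (deriv ^^ Suc i) f x) (at x within cball 0 (r / 2))"
    if "x \<in> cball 0 (r / 2)" for i x
  proof -
    have "x \<in> U" using that U r by auto
    then show ?thesis
      using holomorphic_derivI[OF holomorphic_higher_deriv[OF hol U(1)] U(1)] by simp
  qed
  have mem: "0 \<in> cball (0::complex) (r / 2)" "l \<in> cball 0 (r / 2)"
    using r l by auto
  show "norm (f l - f 0) \<le> 2 * M / r * norm l"
    using complex_Taylor[of "cball 0 (r / 2)" 0 "\<lambda>i. (deriv ^^ i) f" "2 * M / r" 0 l, OF _ der]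
      bd[of _ 1] mem
    by (simp add: mult.commute)
  have "norm ((deriv ^^ Suc 1) f x) \<le> 8 * M / r\<^sup>2" if "x \<in> cball 0 (r / 2)" for x
    using bd[OF that, of 2] by (simp add: numeral_2_eq_2 power2_eq_square)
  then show "norm (f l - f 0 - deriv f 0 * l) \<le> 8 * M / r\<^sup>2 * (norm l)\<^sup>2"
    using complex_Taylor[of "cball 0 (r / 2)" 1 "\<lambda>i. (deriv ^^ i) f" "8 * M / r\<^sup>2" 0 l, OF _ der] mem
    by (simp add: algebra_simps numeral_2_eq_2)
qed

text \<open>The one-variable Cauchy inequality for the slice in direction \<open>v\<close>: the disc
  of radius \<open>r / norm v\<close> is mapped into \<open>cball z r\<close>.\<close>

lemma Cauchy_estimate_several:
  fixes z :: "complex ^ 'n::finite"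
  assumes hol: "holomorphic_several_on f S" and S: "open S" "cball z r \<subseteq> S" and r: "0 < r"
    and B: "\<And>w. w \<in> cball z r \<Longrightarrow> norm (f w) \<le> B"
    and D: "(f has_derivative D) (at z)" "\<And>c v. D (c *s v) = c * D v"
  shows "norm (D v) \<le> B / r * norm v"
proof (cases "v = 0")
  case True
  then show ?thesis
    using D(2)[of 0 0] by simp
next
  case False
  define U where "U = {l. z + l *s v \<in> S}"
  have hU: "(\<lambda>l. f (z + l *s v)) holomorphic_on U"
    unfolding U_def by (rule holomorphic_on_slice[OF hol])
  have mem: "z + l *s v \<in> cball z r" if "norm l \<le> r / norm v" for l
    using that False by (simp add: dist_norm norm_vector_smult field_simps)
  then have sub: "cball 0 (r / norm v) \<subseteq> U"
    using S by (auto simp: U_def)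
  have "norm ((deriv ^^ 1) (\<lambda>l. f (z + l *s v)) 0) \<le> fact 1 * B / (r / norm v) ^ 1"
  proof (rule Cauchy_inequality)
    show "(\<lambda>l. f (z + l *s v)) holomorphic_on ball 0 (r / norm v)"
      "continuous_on (cball 0 (r / norm v)) (\<lambda>l. f (z + l *s v))"
      using sub ball_subset_cball[of "0::complex" "r / norm v"] hU
      by (meson holomorphic_on_imp_continuous_on holomorphic_on_subset order_trans)+
  qed (use r False mem in \<open>auto intro!: B\<close>)
  moreover have "deriv (\<lambda>l. f (z + l *s v)) 0 = D v"
    by (intro DERIV_imp_deriv has_field_derivative_slice) (use D in auto)
  ultimately show ?thesis
    by simp
qed

text \<open>Around \<open>z\<close> there is a ball of radius \<open>R - r\<close> inside
  \<open>cball 0 R\<close>, and the direction of differentiation is \<open>z\<close> itself, of norm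
  below 1.\<close>

lemma radial_deriv_bound:
  fixes z :: "complex ^ 'n::finite"
  assumes f: "holomorphic_several_on f (ball 0 1)" and R: "norm z \<le> r" "r < R" "R < 1"
    and B: "\<And>w. w \<in> cball 0 R \<Longrightarrow> norm (f w) \<le> B"
  shows "norm (radial_deriv f z) \<le> B / (R - r)"
proof -
  from R have z: "z \<in> ball 0 1" by simp
  obtain D where D: "(f has_derivative D) (at z)" "\<And>c v. D (c *s v) = c * D v"
    using f z by (auto elim: holomorphic_several_onE)
  have sub: "cball z (R - r) \<subseteq> cball 0 R"
  proof
    fix y assume "y \<in> cball z (R - r)"
    then show "y \<in> cball 0 R"
      using R norm_triangle_ineq[of z "y - z"] by (simp add: dist_norm norm_minus_commute)
  qed
  moreover have "cball 0 R \<subseteq> ball (0 :: complex ^ 'n) 1" using R by auto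
  ultimately have "norm (D z) \<le> B / (R - r) * norm z"
    by (intro Cauchy_estimate_several[OF f _ _ _ _ D]) (use B R in auto)
  also have "0 \<le> B"
    using order_trans[OF norm_ge_zero B[of z]] R by simp
  then have "B / (R - r) * norm z \<le> B / (R - r)"
    using R z by (intro mult_left_le) auto
  finally show ?thesis
    by (simp add: radial_deriv_eq[OF D])
qed

text \<open>Cauchy's estimates for \<open>f m - f n\<close> make the derivatives uniformly Cauchy on
  a small ball, so the limit may be differentiated termwise. The limit of the derivatives inherits
  complex homogeneity pointwise.\<close>

lemma holomorphic_several_on_uniform_limit:
  fixes S :: "(complex ^ 'n::finite) set"
  assumes S: "open S" and hol: "\<And>k. holomorphic_several_on (f k) S"
    and lim: "uniform_limit S f h sequentially"
  shows "holomorphic_several_on h S"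
  unfolding holomorphic_several_on_def
proof
  fix z assume "z \<in> S"
  then obtain r' where r': "0 < r'" "cball z r' \<subseteq> S"
    using S open_contains_cball by metis
  \<comment> \<open>Half the radius, so that every point of \<open>ball z r\<close> is the centre of
    a closed ball of the same radius \<open>r\<close> inside \<open>S\<close>.\<close>
  define r where "r = r' / 2"
  have r: "0 < r" using r' by (simp add: r_def)
  have sub: "cball w r \<subseteq> S" if "w \<in> ball z r" for w
  proof
    fix y assume "y \<in> cball w r"
    with that have "y \<in> cball z r'"
      using dist_triangle[of z y w] by (simp add: r_def)
    then show "y \<in> S" using r' by blast
  qed
  then have ballS: "ball z r \<subseteq> S" using r by fastforce
  have "\<forall>k. \<forall>w\<in>S. \<exists>D. (f k has_derivative D) (at w) \<and> (\<forall>c v. D (c *s v) = c * D v)"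
    using hol by (simp add: holomorphic_several_on_def)
  then obtain D where D: "\<And>k w. w \<in> S \<Longrightarrow> (f k has_derivative D k w) (at w)"
    "\<And>k w c v. w \<in> S \<Longrightarrow> D k w (c *s v) = c * D k w v"
    by metis
  have cau: "\<exists>N. \<forall>m\<ge>N. \<forall>n\<ge>N. \<forall>w\<in>ball z r. \<forall>v. norm (D m w v - D n w v) \<le> e * norm v"
    if "0 < e" for e
  proof -
    have "0 < e * r / 2" using that r by simp
    then obtain N where N: "\<And>n w. n \<ge> N \<Longrightarrow> w \<in> S \<Longrightarrow> dist (f n w) (h w) < e * r / 2"
      using uniform_limitD[OF lim] by (fastforce simp: eventually_sequentially)
    have "norm (D m w v - D n w v) \<le> e * norm v" if mn: "m \<ge> N" "n \<ge> N" and w: "w \<in> ball z r" for m n w v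
    proof -
      have wS: "w \<in> S" using w ballS by blast
      have "norm (D m w v - D n w v) \<le> (e * r) / r * norm v"
      proof (rule Cauchy_estimate_several[where f = "\<lambda>x. f m x - f n x" and z = w])
        show "holomorphic_several_on (\<lambda>x. f m x - f n x) S"
          by (intro holomorphic_several_on_diff hol)
        show "norm (f m x - f n x) \<le> e * r" if "x \<in> cball w r" for x
        proof -
          have "x \<in> S" using that sub[OF w] by blast
          then show ?thesis
            using N[of m x] N[of n x] mn dist_triangle2[of "f m x" "f n x" "h x"]
            by (simp add: dist_norm)
        qed
      qed (use S sub[OF w] r wS D in \<open>auto intro!: has_derivative_diff simp: algebra_simps\<close>)
      then show ?thesis using r by simp
    qed
    then show ?thesis by blast
  qed
  define E where "E = (\<lambda>w v. lim (\<lambda>k. D k w v))"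
  have E: "(\<lambda>k. D k w v) \<longlonglongrightarrow> E w v" if w: "w \<in> ball z r" for w v
  proof -
    have "Cauchy (\<lambda>k. D k w v)"
    proof (rule metric_CauchyI)
      fix e :: real assume e: "0 < e"
      define e' where "e' = e / (norm v + 1)"
      have "0 < norm v + 1" by (simp add: add_nonneg_pos)
      then have e': "0 < e'" "e' * norm v < e"
        using e by (auto simp: e'_def field_simps)
      from cau[OF e'(1)] obtain N where "\<forall>m\<ge>N. \<forall>n\<ge>N. norm (D m w v - D n w v) \<le> e' * norm v"
        using w by blast
      then show "\<exists>N. \<forall>m\<ge>N. \<forall>n\<ge>N. dist (D m w v) (D n w v) < e"
        using e'(2) by (intro exI[of _ N]) (auto simp: dist_norm intro: le_less_trans)
    qed
    then show ?thesis
      by (simp add: E_def Cauchy_convergent convergent_LIMSEQ_iff[symmetric])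
  qed
  \<comment> \<open>Termwise differentiation produces its own limit function \<open>k\<close>;
    uniqueness of limits identifies it with \<open>h\<close> on the small ball.\<close>
  have "\<exists>k. \<forall>w\<in>ball z r. (\<lambda>n. f n w) \<longlonglongrightarrow> k w \<and> (k has_derivative E w) (at w within ball z r)"
  proof (rule has_derivative_sequence)
    show "(f n has_derivative D n w) (at w within ball z r)" if "w \<in> ball z r" for n w
      using D(1) ballS that by (blast intro: has_derivative_at_withinI)
    show "z \<in> ball z r" using r by simp
    show "(\<lambda>n. f n z) \<longlonglongrightarrow> h z"
      using tendsto_uniform_limitI[OF lim \<open>z \<in> S\<close>] .
    fix e :: real assume e: "0 < e"
    from cau[OF e] obtain N where
      N: "\<And>m n w v. m \<ge> N \<Longrightarrow> n \<ge> N \<Longrightarrow> w \<in> ball z r \<Longrightarrow> norm (D m w v - D n w v) \<le> e * norm v"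
      by blast
    have "norm (D n w v - E w v) \<le> e * norm v" if "n \<ge> N" "w \<in> ball z r" for n w v
    proof (rule Lim_norm_ubound)
      show "(\<lambda>m. D n w v - D m w v) \<longlonglongrightarrow> D n w v - E w v"
        by (intro tendsto_intros E that)
      show "\<forall>\<^sub>F m in sequentially. norm (D n w v - D m w v) \<le> e * norm v"
        unfolding eventually_sequentially using N that by blast
    qed simp
    then show "\<forall>\<^sub>F n in sequentially. \<forall>w\<in>ball z r. \<forall>v. norm (D n w v - E w v) \<le> e * norm v"
      unfolding eventually_sequentially by blast
  qed simp
  then obtain k where k: "\<And>w. w \<in> ball z r \<Longrightarrow> (\<lambda>n. f n w) \<longlonglongrightarrow> k w"
    "(k has_derivative E z) (at z within ball z r)"
    using r by (metis centre_in_ball)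
  have "k w = h w" if "w \<in> ball z r" for w
    using LIMSEQ_unique[OF k(1)[OF that] tendsto_uniform_limitI[OF lim subsetD[OF ballS that]]] .
  moreover have "(k has_derivative E z) (at z)"
    using k(2) at_within_open[of z "ball z r"] r by simp
  ultimately have "(h has_derivative E z) (at z)"
    using r by (intro has_derivative_transform_within_open[of k "E z" z UNIV "ball z r" h]) auto
  moreover have "E z (c *s v) = c * E z v" for c v
  proof (rule LIMSEQ_unique)
    have zb: "z \<in> ball z r" using r by simp
    show "(\<lambda>k. D k z (c *s v)) \<longlonglongrightarrow> E z (c *s v)" by (rule E[OF zb])
    show "(\<lambda>k. D k z (c *s v)) \<longlonglongrightarrow> c * E z v"
      unfolding D(2)[OF \<open>z \<in> S\<close>] by (intro tendsto_intros E zb)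
  qed
  ultimately show "\<exists>D. (h has_derivative D) (at z) \<and> (\<forall>c v. D (c *s v) = c * D v)"
    by blast
qed

lemma holomorphic_several_on_local:
  assumes "\<And>z. z \<in> S \<Longrightarrow> \<exists>T. z \<in> T \<and> holomorphic_several_on f T"
  shows "holomorphic_several_on f S"
  using assms unfolding holomorphic_several_on_def by blast

lemma bounded_on_smaller_ball:
  fixes f :: "complex ^ 'n::finite \<Rightarrow> complex"
  assumes "continuous_on (ball 0 1) f" "R < 1"
  obtains B where "0 < B" "\<And>w. w \<in> cball 0 R \<Longrightarrow> norm (f w) \<le> B"
proof -
  have "compact (f ` cball 0 R)"
    using assms by (intro compact_continuous_image continuous_on_subset[OF assms(1)]) auto
  then obtain B where "0 < B" "\<And>x. x \<in> f ` cball 0 R \<Longrightarrow> norm x \<le> B"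
    using compact_imp_bounded bounded_pos by metis
  then show ?thesis using that by blast
qed

text \<open>\<open>radial_deriv g w\<close> is the derivative of \<open>g ((1 + l) *s w)\<close> at
  \<open>l = 0\<close>. The difference quotients are combinations of \<open>g\<close> and its
  dilations, hence holomorphic, and the second-order Taylor bound makes their convergence uniform on
  \<open>ball 0 r\<close>.\<close>

lemma holomorphic_radial_deriv:
  fixes g :: "complex ^ 'n::finite \<Rightarrow> complex"
  assumes g: "holomorphic_several_on g (ball 0 1)"
  shows "holomorphic_several_on (radial_deriv g) (ball 0 1)"
proof (rule holomorphic_several_on_local)
  fix z :: "complex ^ 'n" assume "z \<in> ball 0 1"
  then obtain r where r: "norm z < r" "r < 1"
    using dense[of "norm z" 1] by auto
  from r obtain R where R: "r < R" "R < 1"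
    using dense by blast
  define d where "d = R - r"
  have d: "0 < d" using R by (simp add: d_def)
  obtain M where M: "0 < M" "\<And>w. w \<in> cball 0 R \<Longrightarrow> norm (g w) \<le> M"
    using bounded_on_smaller_ball[OF holomorphic_several_on_imp_continuous_on[OF g] R(2)] by blast
  have mem: "w + l *s w \<in> cball 0 R" if "w \<in> ball 0 r" "norm l \<le> d" for w :: "complex ^ 'n" and l
  proof -
    have "norm l * norm w \<le> d * 1"
      using that r d by (intro mult_mono) auto
    then show ?thesis
      using that norm_triangle_ineq[of w "l *s w"] by (simp add: norm_vector_smult d_def)
  qed
  have RS: "cball 0 R \<subseteq> ball (0 :: complex ^ 'n) 1" using R by auto
  \<comment> \<open>Nonzero increments tending to 0, of modulus at most \<open>d / 2\<close> as the
    Taylor bound with radius \<open>d\<close> requires.\<close>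
  define e where "e = (\<lambda>k. of_real (d / 2 / real (Suc k)) :: complex)"
  define G where "G = (\<lambda>k w. (g ((1 + e k) *s w) - g w) / e k)"
  have e: "e k \<noteq> 0" "norm (e k) \<le> d / 2" for k
  proof -
    show "e k \<noteq> 0" using d unfolding e_def of_real_eq_0_iff by simp
    have "d / 2 / real (Suc k) \<le> d / 2 / 1"
      using d by (intro divide_left_mono) auto
    moreover have "norm (e k) = d / 2 / real (Suc k)"
      using d by (simp only: e_def norm_of_real) simp
    ultimately show "norm (e k) \<le> d / 2" by simp
  qed
  have smult_eq: "(1 + l) *s w = w + l *s w" for l and w :: "complex ^ 'n"
    by (simp add: vec_eq_iff algebra_simps)
  have bound: "norm (G k w - radial_deriv g w) \<le> 8 * M / d\<^sup>2 * norm (e k)" if w: "w \<in> ball 0 r" for k w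
  proof -
    define h where "h = (\<lambda>l. g (w + l *s w))"
    have "norm (h (e k) - h 0 - deriv h 0 * e k) \<le> 8 * M / d\<^sup>2 * (norm (e k))\<^sup>2"
    proof (rule Cauchy_Taylor_bounds(2))
      show "h holomorphic_on {l. w + l *s w \<in> ball 0 1}"
        unfolding h_def by (rule holomorphic_on_slice[OF g])
      show "open {l. w + l *s w \<in> ball 0 1}" by (rule open_slice) simp
      show "cball 0 d \<subseteq> {l. w + l *s w \<in> ball 0 1}"
      proof
        fix l :: complex assume "l \<in> cball 0 d"
        then have "w + l *s w \<in> cball 0 R" using mem[OF w] by simp
        then show "l \<in> {l. w + l *s w \<in> ball 0 1}" using RS by blast
      qed
      show "norm (h l) \<le> M" if "l \<in> cball 0 d" for l
        unfolding h_def using that by (intro M mem w) simp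
    qed (use d e in auto)
    moreover have "deriv h 0 = radial_deriv g w"
    proof -
      have "w \<in> ball 0 1" using w r by simp
      then obtain D where D: "(g has_derivative D) (at w)" "\<And>c v. D (c *s v) = c * D v"
        using g by (auto elim: holomorphic_several_onE)
      show ?thesis
        unfolding h_def radial_deriv_eq[OF D]
        by (intro DERIV_imp_deriv has_field_derivative_slice) (use D in auto)
    qed
    moreover have "h (e k) - h 0 - radial_deriv g w * e k = (G k w - radial_deriv g w) * e k"
      using e(1)[of k] by (simp add: h_def G_def smult_eq field_simps)
    ultimately have "norm (G k w - radial_deriv g w) * norm (e k) \<le> 8 * M / d\<^sup>2 * norm (e k) * norm (e k)"
      by (simp add: norm_mult power2_eq_square)
    then show ?thesis
      using e(1)[of k] by (simp only: mult_le_cancel_right) auto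
  qed
  have "uniform_limit (ball 0 r) G (radial_deriv g) sequentially"
  proof (rule uniform_limitI)
    fix \<epsilon> :: real assume "0 < \<epsilon>"
    have "(\<lambda>k. 8 * M / d\<^sup>2 * norm (e k)) \<longlonglongrightarrow> 8 * M / d\<^sup>2 * norm (of_real (d / 2 * 0) :: complex)"
      unfolding e_def divide_inverse[of "_ / 2"]
      by (intro tendsto_intros LIMSEQ_inverse_real_of_nat)
    then have "\<forall>\<^sub>F k in sequentially. 8 * M / d\<^sup>2 * norm (e k) < \<epsilon>"
      using \<open>0 < \<epsilon>\<close> by (intro order_tendstoD) auto
    then show "\<forall>\<^sub>F k in sequentially. \<forall>w\<in>ball 0 r. dist (G k w) (radial_deriv g w) < \<epsilon>"
      by eventually_elim (auto simp: dist_norm intro: le_less_trans[OF bound])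
  qed
  moreover have "holomorphic_several_on (G k) (ball 0 r)" for k
  proof -
    have "(1 + e k) *s w \<in> ball 0 1" if "w \<in> ball 0 r" for w :: "complex ^ 'n"
      unfolding smult_eq using mem[OF that, of "e k"] RS e(2)[of k] d by (auto simp del: mem_ball)
    then have "holomorphic_several_on (\<lambda>w. inverse (e k) * (g ((1 + e k) *s w) - g w)) (ball 0 r)"
      using r by (intro holomorphic_several_on_cmult holomorphic_several_on_diff
          holomorphic_several_on_dilation[OF g] holomorphic_several_on_subset[OF g]) auto
    then show ?thesis by (simp add: G_def divide_inverse mult.commute)
  qed
  ultimately have "holomorphic_several_on (radial_deriv g) (ball 0 r)"
    using holomorphic_several_on_uniform_limit[OF open_ball] by blast
  then show "\<exists>T. z \<in> T \<and> holomorphic_several_on (radial_deriv g) T"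
    using r by (intro exI[of _ "ball 0 r"]) auto
qed

text \<open>
  Through every point passes a complex line on which \<open>h\<close> does not vanish identically; on a small
  circle of that line around the point \<open>h\<close> is bounded away from zero, and this persists for nearby
  centres. The maximum principle on the disc then bounds \<open>f\<close> by \<open>f h\<close> on the circle.
\<close>

lemma local_division_bound:
  fixes z0 :: "complex ^ 'n::finite"
  assumes h: "holomorphic_several_on h (ball 0 1)" and p: "p \<in> ball 0 1" "h p \<noteq> 0"
    and z0: "z0 \<in> ball 0 1"
  obtains e C R where "0 < e" "cball z0 e \<subseteq> ball 0 1" "0 < C" "R < 1"
    "\<And>f B z. holomorphic_several_on f (ball 0 1) \<Longrightarrow>
       (\<And>w. w \<in> cball 0 R \<Longrightarrow> norm (f w * h w) \<le> B) \<Longrightarrow> z \<in> cball z0 e \<Longrightarrow> norm (f z) \<le> C * B"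
proof -
  define v where "v = p - z0"
  define U where "U = {l. z0 + l *s v \<in> ball 0 1}"
  have U: "open U" "convex U" "0 \<in> U" "1 \<in> U"
    using open_slice[of "ball 0 1" z0 v] convex_slice[of "ball 0 1" z0 v] z0 p
    by (auto simp: U_def v_def)
  \<comment> \<open>The parameter 1 corresponds to \<open>p\<close>, where \<open>h\<close> is
    nonzero, and \<open>U\<close> is connected. So 0 has a punctured neighbourhood free of zeros,
    even if \<open>h z0 = 0\<close>.\<close>
  have "\<forall>\<^sub>F l in at 0. h (z0 + l *s v) \<noteq> 0 \<and> l \<in> U"
  proof (rule non_zero_neighbour_alt[where \<beta> = 1])
    show "(\<lambda>l. h (z0 + l *s v)) holomorphic_on U"
      unfolding U_def by (rule holomorphic_on_slice[OF h])
  qed (use U p in \<open>auto simp: v_def convex_connected\<close>)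
  then obtain \<rho> where \<rho>: "0 < \<rho>" "\<And>l. l \<noteq> 0 \<Longrightarrow> norm l \<le> \<rho> \<Longrightarrow> h (z0 + l *s v) \<noteq> 0 \<and> l \<in> U"
    by (auto simp: eventually_at_le)
  define K where "K = (\<lambda>l. z0 + l *s v) ` sphere 0 \<rho>"
  define L where "L = (\<lambda>l. z0 + l *s v) ` cball 0 \<rho>"
  have cpt: "compact K" "compact L"
    unfolding K_def L_def by (intro compact_continuous_image continuous_intros compact_sphere compact_cball)+
  have LU: "L \<subseteq> ball 0 1"
  proof
    fix w assume "w \<in> L"
    then obtain l where l: "w = z0 + l *s v" "norm l \<le> \<rho>" unfolding L_def by force
    then show "w \<in> ball 0 1" using \<rho>(2)[of l] z0 by (cases "l = 0") (auto simp: U_def)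
  qed
  define W where "W = {w \<in> ball 0 1. h w \<noteq> 0}"
  have "open (ball 0 1 \<inter> h -` (- {0}))"
    by (intro continuous_open_preimage holomorphic_several_on_imp_continuous_on[OF h]) auto
  moreover have "W = ball 0 1 \<inter> h -` (- {0})" by (auto simp: W_def)
  ultimately have "open W" by simp
  moreover have "K \<subseteq> W"
    using \<rho> unfolding K_def W_def U_def by (auto simp del: mem_ball)
  ultimately obtain e1 where e1: "0 < e1" "(\<Union>x\<in>K. cball x e1) \<subseteq> W"
    using compact_subset_open_imp_cball_epsilon_subset[OF cpt(1)] by blast
  obtain e2 where e2: "0 < e2" "(\<Union>x\<in>L. cball x e2) \<subseteq> ball 0 1"
    using compact_subset_open_imp_cball_epsilon_subset[OF cpt(2) open_ball LU] by blast
  define e where "e = min e1 e2"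
  have e: "0 < e" using e1 e2 by (simp add: e_def)
  \<comment> \<open>Thickening the circle and the disc by \<open>cball 0 e\<close> lets the centre
    \<open>z\<close> vary near \<open>z0\<close>. Both sets stay compact, so \<open>h\<close> is
    bounded below on \<open>K'\<close> and the norm stays below 1 on \<open>L'\<close>. The
    constants thus depend on \<open>h\<close> and \<open>z0\<close> but not on \<open>f\<close>,
    \<open>B\<close> or \<open>z\<close>.\<close>
  define K' where "K' = {x + y |x y. x \<in> K \<and> y \<in> cball 0 e}"
  define L' where "L' = {x + y |x y. x \<in> L \<and> y \<in> cball 0 e}"
  have cpt': "compact K'" "compact L'"
    unfolding K'_def L'_def by (intro compact_sums cpt compact_cball)+
  have K'W: "K' \<subseteq> W"
  proof
    fix w assume "w \<in> K'"
    then obtain x y where "w = x + y" "x \<in> K" "norm y \<le> e" by (auto simp: K'_def)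
    then have "w \<in> cball x e1" by (simp add: e_def dist_norm)
    then show "w \<in> W" using e1(2) \<open>x \<in> K\<close> by blast
  qed
  have L'1: "L' \<subseteq> ball 0 1"
  proof
    fix w assume "w \<in> L'"
    then obtain x y where "w = x + y" "x \<in> L" "norm y \<le> e" by (auto simp: L'_def)
    then have "w \<in> cball x e2" by (simp add: e_def dist_norm)
    then show "w \<in> ball 0 1" using e2(2) \<open>x \<in> L\<close> by blast
  qed
  have mem: "z + l *s v \<in> {x + y |x y. x \<in> (\<lambda>l. z0 + l *s v) ` A \<and> y \<in> cball 0 e}"
    if "z \<in> cball z0 e" "l \<in> A" for z l A
  proof -
    have "z + l *s v = (z0 + l *s v) + (z - z0)" by simp
    moreover have "z - z0 \<in> cball 0 e" using that by (simp add: dist_norm norm_minus_commute)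
    ultimately show ?thesis using that by blast
  qed
  have memK: "z + l *s v \<in> K'" if "z \<in> cball z0 e" "l \<in> sphere 0 \<rho>" for z l
    unfolding K'_def K_def using mem[OF that] .
  have memL: "z + l *s v \<in> L'" if "z \<in> cball z0 e" "l \<in> cball 0 \<rho>" for z l
    unfolding L'_def L_def using mem[OF that] .
  have zL: "z \<in> L'" if "z \<in> cball z0 e" for z
    using memL[OF that, of 0] \<rho> by simp
  have ne: "K' \<noteq> {}" "L' \<noteq> {}"
    using memK[of z0 "of_real \<rho>"] zL[of z0] e \<rho> by auto
  obtain w0 where w0: "w0 \<in> K'" "\<And>w. w \<in> K' \<Longrightarrow> norm (h w0) \<le> norm (h w)"
  proof -
    have "continuous_on K' (\<lambda>w. norm (h w))"
      using K'W by (intro continuous_on_norm continuous_on_subset[OF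
            holomorphic_several_on_imp_continuous_on[OF h]]) (auto simp: W_def)
    then show ?thesis
      using continuous_attains_inf[OF cpt'(1) ne(1)] that by blast
  qed
  define c where "c = norm (h w0)"
  have c: "0 < c" using w0(1) K'W by (auto simp: c_def W_def)
  obtain w1 where w1: "w1 \<in> L'" "\<And>w. w \<in> L' \<Longrightarrow> norm w \<le> norm w1"
    using continuous_attains_sup[OF cpt'(2) ne(2) continuous_on_norm_id] by blast
  define R where "R = norm w1"
  have R: "R < 1" using w1(1) L'1 by (auto simp: R_def)
  have "K \<subseteq> L"
    unfolding K_def L_def by (intro image_mono) auto
  then have KL: "K' \<subseteq> L'"
    unfolding K'_def L'_def by blast
  show ?thesis
  proof
    show "0 < e" by (rule e)
    show "cball z0 e \<subseteq> ball 0 1" using zL L'1 by blast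
    show "0 < 1 / c" using c by simp
    show "R < 1" by (rule R)
    fix f :: "complex ^ 'n \<Rightarrow> complex" and B z
    assume f: "holomorphic_several_on f (ball 0 1)"
      and B: "\<And>w. w \<in> cball 0 R \<Longrightarrow> norm (f w * h w) \<le> B" and z: "z \<in> cball z0 e"
    have sub: "cball 0 \<rho> \<subseteq> {l. z + l *s v \<in> ball 0 1}"
      using memL[OF z] L'1 by blast
    have "norm (f (z + 0 *s v)) \<le> 1 / c * B"
    proof (rule maximum_modulus_frontier[of "\<lambda>l. f (z + l *s v)" "cball 0 \<rho>"])
      show "(\<lambda>l. f (z + l *s v)) holomorphic_on interior (cball 0 \<rho>)"
        using sub interior_subset by (intro holomorphic_on_subset[OF holomorphic_on_slice[OF f]]) blast
      show "continuous_on (closure (cball 0 \<rho>)) (\<lambda>l. f (z + l *s v))"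
        using holomorphic_on_imp_continuous_on[OF holomorphic_on_subset[OF holomorphic_on_slice[OF f] sub]]
        by simp
      show "bounded (cball (0::complex) \<rho>)" "0 \<in> cball (0::complex) \<rho>" using \<rho> by auto
      fix l :: complex assume "l \<in> frontier (cball 0 \<rho>)"
      then have l: "l \<in> sphere 0 \<rho>" using \<rho> by (simp add: frontier_cball)
      define w where "w = z + l *s v"
      have w: "w \<in> K'" using memK[OF z l] by (simp add: w_def)
      then have "w \<in> cball 0 R" using KL w1(2) by (auto simp: R_def)
      have "norm (f w) * c \<le> norm (f w) * norm (h w)"
        using w0(2)[OF w] by (intro mult_left_mono) (auto simp: c_def)
      also have "\<dots> \<le> B" using B[OF \<open>w \<in> cball 0 R\<close>] by (simp add: norm_mult)
      finally show "norm (f (z + l *s v)) \<le> 1 / c * B"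
        using c by (simp add: field_simps w_def)
    qed
    then show "norm (f z) \<le> 1 / c * B" by simp
  qed
qed

subsection \<open>Integral means\<close>

lemma finite_measure_sphere_measure: "finite_measure (sphere_measure :: 'a::euclidean_space measure)"
  by (rule finite_measureI) (simp add: space_sphere_measure emeasure_sphere_measure_total)

lemma measure_sphere_measure_total: "measure sphere_measure (space (sphere_measure :: 'a::euclidean_space measure)) = 1"
  by (simp add: measure_def space_sphere_measure emeasure_sphere_measure_total)

lemma borel_measurable_sphere_measure:
  fixes f :: "'a::euclidean_space \<Rightarrow> 'b::topological_space"
  assumes "continuous_on (sphere 0 1) f"
  shows "f \<in> borel_measurable sphere_measure"
proof -
  have "sets (sphere_measure :: 'a measure) = sets (restrict_space borel (sphere 0 1))"
    unfolding sphere_measure_def by (rule sets_restrict_space_cong) simp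
  then show ?thesis
    using borel_measurable_continuous_on_restrict[OF assms] by (simp cong: measurable_cong_sets)
qed

lemma continuous_on_powr_norm:
  fixes f :: "'a::topological_space \<Rightarrow> 'b::real_normed_vector"
  assumes "continuous_on S f" "0 < q"
  shows "continuous_on S (\<lambda>x. norm (f x) powr q)"
  by (rule continuous_on_powr') (use assms in \<open>auto intro!: continuous_intros\<close>)

lemma integrable_hardy_mean:
  fixes f :: "complex ^ 'n::finite \<Rightarrow> complex"
  assumes f: "continuous_on (ball 0 1) f" and s: "0 \<le> s" "s < 1" and q: "0 < q"
  shows "integrable sphere_measure (\<lambda>\<zeta>. norm (f (s *\<^sub>R \<zeta>)) powr q)"
proof -
  interpret finite_measure "sphere_measure :: (complex ^ 'n) measure"
    by (rule finite_measure_sphere_measure)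
  have "continuous_on (sphere 0 1) (\<lambda>\<zeta>. f (s *\<^sub>R \<zeta>))"
    by (rule continuous_on_compose2[OF f]) (use s in \<open>auto intro!: continuous_intros\<close>)
  then have cont: "continuous_on (sphere 0 1) (\<lambda>\<zeta>. norm (f (s *\<^sub>R \<zeta>)) powr q)"
    using q by (rule continuous_on_powr_norm)
  obtain B where "\<And>w. w \<in> cball 0 s \<Longrightarrow> norm (f w) \<le> B"
    using bounded_on_smaller_ball[OF f s(2)] by blast
  then have B: "norm (f (s *\<^sub>R \<zeta>)) powr q \<le> B powr q" if "\<zeta> \<in> sphere 0 1" for \<zeta>
    using that s q by (intro powr_mono2) auto
  show ?thesis
    by (rule integrable_const_bound[where B = "B powr q"])
       (use B cont in \<open>auto simp: space_sphere_measure intro!: AE_I2 borel_measurable_sphere_measure\<close>)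
qed

lemma hardy_mean_nonneg: "0 \<le> hardy_mean q f s"
  by (simp add: hardy_mean_def)

lemma hardy_mean_powr:
  assumes "0 < q"
  shows "hardy_mean q f s powr q = (LINT \<zeta>|sphere_measure. norm (f (s *\<^sub>R \<zeta>)) powr q)"
  using assms by (simp add: hardy_mean_def powr_powr integral_nonneg_AE)

lemma hardy_mean_leI:
  assumes "0 < q" "0 \<le> B" "(LINT \<zeta>|sphere_measure. norm (f (s *\<^sub>R \<zeta>)) powr q) \<le> B powr q"
  shows "hardy_mean q f s \<le> B"
proof -
  have "hardy_mean q f s \<le> (B powr q) powr (1 / q)"
    unfolding hardy_mean_def by (rule powr_mono2) (use assms in \<open>auto intro: integral_nonneg_AE\<close>)
  then show ?thesis using assms by (simp add: powr_powr)
qed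

lemma hardy_mean_le_bound:
  fixes f :: "complex ^ 'n::finite \<Rightarrow> complex"
  assumes f: "continuous_on (ball 0 1) f" and s: "0 \<le> s" "s < 1" and q: "0 < q"
    and B: "0 \<le> B" "\<And>w. norm w \<le> s \<Longrightarrow> norm (f w) \<le> B"
  shows "hardy_mean q f s \<le> B"
proof (rule hardy_mean_leI[OF q B(1)])
  interpret finite_measure "sphere_measure :: (complex ^ 'n) measure"
    by (rule finite_measure_sphere_measure)
  have "(LINT \<zeta>|sphere_measure. norm (f (s *\<^sub>R \<zeta>)) powr q)
      \<le> (LINT \<zeta>|(sphere_measure :: (complex ^ 'n) measure). B powr q)"
    by (rule integral_mono)
       (use s q B in \<open>auto intro!: integrable_hardy_mean[OF f] powr_mono2 simp: space_sphere_measure\<close>)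
  then show "(LINT \<zeta>|sphere_measure. norm (f (s *\<^sub>R \<zeta>)) powr q) \<le> B powr q"
    by (simp add: measure_sphere_measure_total)
qed

lemma hardy_mean_cmult:
  assumes "0 < q"
  shows "hardy_mean q (\<lambda>x. c * f x) s = norm c * hardy_mean q f s"
  using assms by (simp add: hardy_mean_def norm_mult powr_mult powr_powr)

text \<open>The constant collects \<open>2 powr q\<close> from bounding \<open>norm (a + b)\<close>
  by twice the larger norm, and a factor 2 from replacing each of \<open>A powr q\<close> and
  \<open>B powr q\<close> by \<open>(A + B) powr q\<close>; then the \<open>q\<close>-th root is
  taken.\<close>

lemma hardy_mean_add_quasi:
  fixes f h :: "complex ^ 'n::finite \<Rightarrow> complex"
  assumes f: "continuous_on (ball 0 1) f" and h: "continuous_on (ball 0 1) h"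
    and s: "0 \<le> s" "s < 1" and q: "0 < q"
  shows "hardy_mean q (\<lambda>x. f x + h x) s \<le> 2 powr (1 + 1 / q) * (hardy_mean q f s + hardy_mean q h s)"
proof (rule hardy_mean_leI[OF q])
  define A where "A = hardy_mean q f s"
  define B where "B = hardy_mean q h s"
  have AB: "0 \<le> A" "0 \<le> B" by (auto simp: A_def B_def hardy_mean_nonneg)
  have le: "norm (a + b) powr q \<le> 2 powr q * (norm a powr q + norm b powr q)" for a b :: complex
  proof -
    have "norm (a + b) powr q \<le> (2 * max (norm a) (norm b)) powr q"
      using q norm_triangle_ineq[of a b] by (intro powr_mono2) auto
    also have "\<dots> = 2 powr q * max (norm a) (norm b) powr q"
      by (simp add: powr_mult)
    also have "\<dots> \<le> 2 powr q * (norm a powr q + norm b powr q)"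
      by (intro mult_left_mono) (auto simp: max_def)
    finally show ?thesis .
  qed
  have "(LINT \<zeta>|sphere_measure. norm (f (s *\<^sub>R \<zeta>) + h (s *\<^sub>R \<zeta>)) powr q)
      \<le> (LINT \<zeta>|sphere_measure. 2 powr q * (norm (f (s *\<^sub>R \<zeta>)) powr q + norm (h (s *\<^sub>R \<zeta>)) powr q))"
    using integrable_hardy_mean[OF continuous_on_add[OF f h] s q]
      integrable_hardy_mean[OF f s q] integrable_hardy_mean[OF h s q] le
    by (intro integral_mono) auto
  also have "\<dots> = 2 powr q * (A powr q + B powr q)"
    using integrable_hardy_mean[OF f s q] integrable_hardy_mean[OF h s q]
    by (simp add: A_def B_def hardy_mean_powr[OF q])
  also have "\<dots> \<le> 2 powr q * ((A + B) powr q + (A + B) powr q)"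
    using AB q by (intro mult_left_mono add_mono powr_mono2) auto
  also have "\<dots> = 2 powr (q + 1) * (A + B) powr q"
    by (simp add: powr_add)
  also have "\<dots> = (2 powr (1 + 1 / q) * (A + B)) powr q"
    using q by (simp add: powr_mult powr_powr distrib_right add.commute)
  finally show "(LINT \<zeta>|sphere_measure. norm (f (s *\<^sub>R \<zeta>) + h (s *\<^sub>R \<zeta>)) powr q)
      \<le> (2 powr (1 + 1 / q) * (hardy_mean q f s + hardy_mean q h s)) powr q"
    by (simp add: A_def B_def)
qed (simp add: hardy_mean_nonneg)

text \<open>Convexity is applied on the open half-line; if \<open>x\<close> or \<open>y\<close> is
  0, the claim reduces to \<open>t powr q \<le> t\<close> for weights \<open>t\<close> in the unit
  interval.\<close>

lemma powr_convex_nonneg: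
  fixes x y u v q :: real
  assumes "1 \<le> q" "0 \<le> x" "0 \<le> y" "0 \<le> u" "0 \<le> v" "u + v = 1"
  shows "(u * x + v * y) powr q \<le> u * x powr q + v * y powr q"
proof -
  have *: "(t * z) powr q \<le> t * z powr q" if "0 \<le> t" "t \<le> 1" for t z
    using that assms(1) powr_mono'[of 1 q t] by (auto simp: powr_mult intro!: mult_right_mono)
  show ?thesis
  proof (cases "0 < x \<and> 0 < y")
    case True
    moreover have "u = 1 - v" "v \<le> 1" using assms by linarith+
    ultimately show ?thesis
      using convex_onD[OF powr_convex[OF assms(1)], of v x y] assms(5) by simp
  next
    case False
    then have "x = 0 \<or> y = 0" using assms by linarith
    then show ?thesis using *[of u x] *[of v y] assms by auto
  qed
qed

text \<open>
  For \<open>a > hardy_mean q f s\<close> and \<open>b > hardy_mean q h s\<close> apply convexity of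
  \<open>x powr q\<close> to the convex combination of \<open>norm f / a\<close> and \<open>norm h / b\<close> with weights proportional to
  \<open>a\<close> and \<open>b\<close>.
\<close>

lemma hardy_mean_add:
  fixes f h :: "complex ^ 'n::finite \<Rightarrow> complex"
  assumes f: "continuous_on (ball 0 1) f" and h: "continuous_on (ball 0 1) h"
    and s: "0 \<le> s" "s < 1" and q: "1 \<le> q"
  shows "hardy_mean q (\<lambda>x. f x + h x) s \<le> hardy_mean q f s + hardy_mean q h s"
proof -
  define A where "A = hardy_mean q f s"
  define B where "B = hardy_mean q h s"
  have AB: "0 \<le> A" "0 \<le> B" by (auto simp: A_def B_def hardy_mean_nonneg)
  have q0: "0 < q" using q by simp
  \<comment> \<open>Strictly larger \<open>a\<close> and \<open>b\<close> are positive even if a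
    mean vanishes, so dividing by them is safe.\<close>
  have le: "hardy_mean q (\<lambda>x. f x + h x) s \<le> a + b" if ab: "A < a" "B < b" for a b
  proof (rule hardy_mean_leI[OF q0])
    define u where "u = a / (a + b)"
    define v where "v = b / (a + b)"
    have pos: "0 < a" "0 < b" using ab AB by auto
    then have uv: "0 \<le> u" "0 \<le> v" "u + v = 1"
      by (auto simp: u_def v_def simp flip: add_divide_distrib)
    have eq: "u * (x / a) + v * (y / b) = (x + y) / (a + b)" for x y
      using pos by (simp add: u_def v_def add_divide_distrib)
    have pw: "norm (x + y) powr q \<le> (a + b) powr q * (u * (norm x powr q / a powr q) + v * (norm y powr q / b powr q))"
      for x y :: complex
    proof -
      have "norm (x + y) powr q \<le> (norm x + norm y) powr q"
        using q0 norm_triangle_ineq by (intro powr_mono2) auto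
      also have "\<dots> = (a + b) powr q * (u * (norm x / a) + v * (norm y / b)) powr q"
        unfolding eq using pos by (simp add: powr_divide)
      also have "\<dots> \<le> (a + b) powr q * (u * (norm x / a) powr q + v * (norm y / b) powr q)"
        using pos uv by (intro mult_left_mono powr_convex_nonneg q) auto
      finally show ?thesis using pos by (simp add: powr_divide)
    qed
    have "(LINT \<zeta>|sphere_measure. norm (f (s *\<^sub>R \<zeta>) + h (s *\<^sub>R \<zeta>)) powr q)
        \<le> (LINT \<zeta>|sphere_measure. (a + b) powr q *
            (u * (norm (f (s *\<^sub>R \<zeta>)) powr q / a powr q) + v * (norm (h (s *\<^sub>R \<zeta>)) powr q / b powr q)))"
      using integrable_hardy_mean[OF continuous_on_add[OF f h] s q0]
        integrable_hardy_mean[OF f s q0] integrable_hardy_mean[OF h s q0] pw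
      by (intro integral_mono) auto
    also have "\<dots> = (a + b) powr q * (u * (A powr q / a powr q) + v * (B powr q / b powr q))"
      using integrable_hardy_mean[OF f s q0] integrable_hardy_mean[OF h s q0]
      by (simp add: A_def B_def hardy_mean_powr[OF q0])
    also have "\<dots> \<le> (a + b) powr q * (u * 1 + v * 1)"
      using uv pos ab AB q0
      by (intro mult_left_mono add_mono) (auto simp: divide_le_eq_1 intro: powr_mono2)
    finally show "(LINT \<zeta>|sphere_measure. norm (f (s *\<^sub>R \<zeta>) + h (s *\<^sub>R \<zeta>)) powr q) \<le> (a + b) powr q"
      using uv by simp
  qed (use ab AB in auto)
  show ?thesis
  proof (rule field_le_epsilon)
    fix e :: real assume "0 < e"
    then show "hardy_mean q (\<lambda>x. f x + h x) s \<le> hardy_mean q f s + hardy_mean q h s + e"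
      using le[of "A + e / 2" "B + e / 2"] by (simp add: A_def B_def)
  qed
qed

subsection \<open>Boundedness of point evaluations\<close>

text \<open>The cone over the cap contains the ball of radius \<open>\<eta> / 4\<close> about
  \<open>u /\<^sub>R 2\<close>, and surface measure is by definition the volume fraction of the
  cone.\<close>

lemma measure_sphere_cap_ge:
  fixes u :: "'a::euclidean_space"
  assumes u: "norm u = 1" and \<eta>: "0 < \<eta>" "\<eta> \<le> 1"
  shows "(\<eta> / 4) ^ DIM('a) \<le> measure sphere_measure (sphere 0 1 \<inter> ball u (2 * \<eta>))"
proof -
  define E where "E = sphere (0::'a) 1 \<inter> ball u (2 * \<eta>)"
  define V where "V = measure lborel (ball (0::'a) 1)"
  have V: "0 < V" by (simp add: V_def)
  have E: "E \<in> sets borel" "E \<subseteq> sphere 0 1"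
    by (auto simp: E_def)
  have sub: "ball (u /\<^sub>R 2) (\<eta> / 4) \<subseteq> {x \<in> ball 0 1. sgn x \<in> E}"
  proof
    fix x assume "x \<in> ball (u /\<^sub>R 2) (\<eta> / 4)"
    then have x: "norm (x - u /\<^sub>R 2) < \<eta> / 4" by (simp add: dist_norm norm_minus_commute)
    have nu: "norm (u /\<^sub>R 2) = 1 / 2" using u by simp
    have nx: "\<bar>norm x - 1 / 2\<bar> < \<eta> / 4"
      using x norm_triangle_ineq3[of x "u /\<^sub>R 2"] nu by simp
    have "norm (x - norm x *\<^sub>R u) \<le> norm (x - u /\<^sub>R 2) + norm (u /\<^sub>R 2 - norm x *\<^sub>R u)"
      using norm_triangle_ineq[of "x - u /\<^sub>R 2" "u /\<^sub>R 2 - norm x *\<^sub>R u"] by simp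
    also have "u /\<^sub>R 2 - norm x *\<^sub>R u = (1 / 2 - norm x) *\<^sub>R u"
      by (simp add: algebra_simps)
    finally have "norm (x - norm x *\<^sub>R u) < \<eta> / 2"
      using x nx u by (simp add: abs_minus_commute)
    \<comment> \<open>Points of the small ball keep distance \<open>1 / 4\<close> from the origin,
      so normalizing them enlarges the error \<open>\<eta> / 2\<close> at most fourfold, to
      \<open>2 * \<eta>\<close>.\<close>
    moreover have x0: "1 / 4 < norm x" "norm x < 1" using nx \<eta> by linarith+
    ultimately have "norm (x - norm x *\<^sub>R u) / norm x < (\<eta> / 2) / (1 / 4)"
      using \<eta> by (intro frac_less) auto
    moreover have "sgn x - u = (x - norm x *\<^sub>R u) /\<^sub>R norm x"
    proof -
      have "x \<noteq> 0" using x0 by auto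
      then show ?thesis by (simp add: sgn_div_norm scaleR_diff_right)
    qed
    then have "norm (sgn x - u) = norm (x - norm x *\<^sub>R u) / norm x"
      by (simp only: norm_scaleR) (simp add: divide_inverse_commute)
    ultimately have "norm (sgn x - u) < 2 * \<eta>"
      by simp
    then show "x \<in> {x \<in> ball 0 1. sgn x \<in> E}"
      using x0 by (auto simp: E_def norm_sgn dist_norm norm_minus_commute)
  qed
  have content: "emeasure lborel (ball c r) = ennreal (r ^ DIM('a) * V)" if "0 \<le> r" for c :: 'a and r
    using content_ball_conv_unit_ball[OF that, of c] emeasure_lborel_ball_finite[of c r]
    by (simp add: V_def emeasure_eq_ennreal_measure)
  have "{x \<in> ball 0 1. sgn x \<in> E} = ball 0 1 \<inter> sgn -` E" by auto
  moreover have "sgn -` E \<in> sets (borel :: 'a measure)"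
    using measurable_sets[OF borel_measurable_sgn E(1)] by simp
  ultimately have meas: "{x \<in> ball 0 1. sgn x \<in> E} \<in> sets lborel" by simp
  have "ennreal ((\<eta> / 4) ^ DIM('a)) = ennreal ((\<eta> / 4) ^ DIM('a) * V) / ennreal (1 ^ DIM('a) * V)"
    using V \<eta> by (simp add: divide_ennreal)
  also have "\<dots> = emeasure lborel (ball (u /\<^sub>R 2) (\<eta> / 4)) / emeasure lborel (ball (0::'a) 1)"
    using \<eta> by (simp only: content zero_le_one)
  also have "\<dots> \<le> emeasure lborel {x \<in> ball 0 1. sgn x \<in> E} / emeasure lborel (ball (0::'a) 1)"
    by (rule divide_right_mono_ennreal[OF emeasure_mono[OF sub meas]])
  also have "\<dots> = emeasure sphere_measure E"
    by (rule emeasure_sphere_measure[OF E, symmetric])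
  also have "\<dots> = ennreal (measure sphere_measure E)"
    by (rule finite_measure.emeasure_eq_measure[OF finite_measure_sphere_measure])
  finally show ?thesis
    by (simp add: E_def)
qed

text \<open>On the slice through \<open>z\<close> and \<open>x\<close>, with \<open>x\<close> at
  parameter 1, this is the first-order one-variable bound on the disc of radius
  \<open>d / norm (x - z)\<close>.\<close>

lemma norm_diff_le_of_bounded:
  fixes z :: "complex ^ 'n::finite"
  assumes h: "holomorphic_several_on h S" and S: "open S" "cball z d \<subseteq> S" and d: "0 < d"
    and M: "\<And>w. w \<in> cball z d \<Longrightarrow> norm (h w) \<le> M" and x: "norm (x - z) \<le> d / 2"
  shows "norm (h x - h z) \<le> 2 * M / d * norm (x - z)"
proof (cases "x = z")
  case False
  define v where "v = x - z"
  have v: "0 < norm v" using False by (simp add: v_def)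
  have mem: "z + l *s v \<in> cball z d" if "norm l \<le> d / norm v" for l
    using that v by (simp add: dist_norm norm_vector_smult field_simps)
  have "norm (h (z + 1 *s v) - h (z + 0 *s v)) \<le> 2 * M / (d / norm v) * norm (1 :: complex)"
  proof (rule Cauchy_Taylor_bounds(1))
    show "(\<lambda>l. h (z + l *s v)) holomorphic_on {l. z + l *s v \<in> S}"
      by (rule holomorphic_on_slice[OF h])
    show "open {l. z + l *s v \<in> S}" by (rule open_slice[OF S(1)])
    show "cball 0 (d / norm v) \<subseteq> {l. z + l *s v \<in> S}" using mem S(2) by fastforce
    show "0 < d / norm v" using d v by simp
    show "norm (h (z + l *s v)) \<le> M" if "l \<in> cball 0 (d / norm v)" for l
      using that by (intro M mem) simp
    show "norm (1 :: complex) \<le> d / norm v / 2"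
      using x v by (simp add: v_def field_simps)
  qed
  then show ?thesis by (simp add: v_def)
qed simp

text \<open>Only the cap about the direction of \<open>z\<close> is kept in the integral; scaled by
  \<open>norm z\<close>, it stays within \<open>2 * \<eta>\<close> of \<open>z\<close>. The exponent
  is the dimension in the measure of the cap after taking the \<open>q\<close>-th root.\<close>

lemma hardy_mean_ge_of_lower_bound:
  fixes h :: "complex ^ 'n::finite \<Rightarrow> complex"
  assumes h: "continuous_on (ball 0 1) h" and z: "norm z < 1" and q: "0 < q"
    and \<eta>: "0 < \<eta>" "\<eta> \<le> 1" and m: "0 \<le> m"
    and le: "\<And>x. norm x < 1 \<Longrightarrow> norm (x - z) < 2 * \<eta> \<Longrightarrow> m \<le> norm (h x)"
  shows "m * (\<eta> / 4) powr (real DIM(complex ^ 'n) / q) \<le> hardy_mean q h (norm z)"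
proof -
  interpret finite_measure "sphere_measure :: (complex ^ 'n) measure"
    by (rule finite_measure_sphere_measure)
  define s where "s = norm z"
  have s: "0 \<le> s" "s < 1" using z by (auto simp: s_def)
  \<comment> \<open>For \<open>z = 0\<close> any unit vector serves as direction.\<close>
  obtain u where u: "norm u = 1" "z = s *\<^sub>R u"
  proof (cases "z = 0")
    case True
    obtain u :: "complex ^ 'n" where "norm u = 1"
      using vector_choose_size[of 1] by auto
    then show ?thesis using True that by (auto simp: s_def)
  next
    case False
    then show ?thesis using that[of "sgn z"] by (simp add: s_def norm_sgn sgn_div_norm)
  qed
  define E where "E = sphere 0 1 \<inter> ball u (2 * \<eta>)"
  have E: "E \<in> sets sphere_measure"
  proof -
    have "sets (sphere_measure :: (complex ^ 'n) measure) = sets (restrict_space borel (sphere 0 1))"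
      unfolding sphere_measure_def by (rule sets_restrict_space_cong) simp
    then show ?thesis by (auto simp: E_def sets_restrict_space)
  qed
  have pw: "indicator E \<zeta> * m powr q \<le> norm (h (s *\<^sub>R \<zeta>)) powr q" for \<zeta>
  proof (cases "\<zeta> \<in> E")
    case True
    then have \<zeta>: "norm \<zeta> = 1" "norm (\<zeta> - u) < 2 * \<eta>"
      by (auto simp: E_def dist_norm norm_minus_commute)
    have "norm (s *\<^sub>R \<zeta> - z) = s * norm (\<zeta> - u)"
      using s by (simp add: u(2) flip: scaleR_diff_right)
    also have "\<dots> \<le> 1 * norm (\<zeta> - u)"
      using s by (intro mult_right_mono) auto
    finally have "m \<le> norm (h (s *\<^sub>R \<zeta>))"
      using \<zeta> s by (intro le) auto
    then show ?thesis using True m q by (simp add: powr_mono2)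
  qed simp
  have "measure sphere_measure E * m powr q = (LINT \<zeta>|sphere_measure. indicator E \<zeta> * m powr q)"
    using E by (simp add: emeasure_finite less_top[symmetric])
  also have "\<dots> \<le> (LINT \<zeta>|sphere_measure. norm (h (s *\<^sub>R \<zeta>)) powr q)"
    using E by (intro integral_mono pw integrable_hardy_mean[OF h s q] integrable_mult_left)
       (simp add: emeasure_finite less_top[symmetric])
  finally have "measure sphere_measure E * m powr q \<le> hardy_mean q h s powr q"
    by (simp add: hardy_mean_powr[OF q])
  moreover have "(\<eta> / 4) powr real DIM(complex ^ 'n) * m powr q \<le> measure sphere_measure E * m powr q"
  proof (rule mult_right_mono)
    have "(\<eta> / 4) powr real DIM(complex ^ 'n) = (\<eta> / 4) ^ DIM(complex ^ 'n)"
      using \<eta> by (intro powr_realpow) simp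
    then show "(\<eta> / 4) powr real DIM(complex ^ 'n) \<le> measure sphere_measure E"
      unfolding E_def using measure_sphere_cap_ge[OF u(1) \<eta>] by simp
  qed simp
  ultimately have "((\<eta> / 4) powr real DIM(complex ^ 'n) * m powr q) powr (1 / q)
      \<le> (hardy_mean q h s powr q) powr (1 / q)"
    using q by (intro powr_mono2) auto
  then show ?thesis
    using q m hardy_mean_nonneg[of q h s] by (simp add: powr_mult powr_powr s_def mult.commute)
qed

text \<open>
  The weight \<open>(\<rho> - norm z) powr (DIM / q)\<close> makes the estimate scale invariant: at a point maximizing
  weight times \<open>norm h\<close> the function \<open>h\<close> is comparable to its value there on a ball of radius
  proportional to \<open>\<delta>\<close>, so by Cauchy's estimate it stays above half of that value on a spherical cap
  of comparable size. No subharmonicity of \<open>norm h powr q\<close> is needed, which covers \<open>q < 1\<close>.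
\<close>

lemma hardy_mean_pointwise_bound:
  assumes q: "0 < q" and r: "0 \<le> r" "r < 1"
  obtains C where "0 < C"
    "\<And>(h :: complex ^ 'n::finite \<Rightarrow> complex) N z. holomorphic_several_on h (ball 0 1) \<Longrightarrow>
       (\<And>s. 0 \<le> s \<Longrightarrow> s < 1 \<Longrightarrow> hardy_mean q h s \<le> N) \<Longrightarrow> z \<in> cball 0 r \<Longrightarrow> norm (h z) \<le> C * N"
proof -
  define \<alpha> where "\<alpha> = real DIM(complex ^ 'n) / q"
  \<comment> \<open>The weight vanishes on the sphere of radius \<open>\<rho>\<close>, so a nonzero
    maximum is attained in the open ball; on \<open>cball 0 r\<close> the weight is at least
    \<open>(\<rho> - r) powr \<alpha>\<close>.\<close>
  define \<rho> where "\<rho> = (1 + r) / 2"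
  \<comment> \<open>Chosen so that the oscillation bound
    \<open>2 * M / \<delta> * (\<kappa> * \<delta>)\<close>, with
    \<open>M = 2 powr \<alpha> * norm (h y)\<close>, equals half of
    \<open>norm (h y)\<close>.\<close>
  define \<kappa> where "\<kappa> = 1 / (4 * 2 powr \<alpha>)"
  \<comment> \<open>The 2 undoes the halving of \<open>norm (h y)\<close>, and
    \<open>16 / \<kappa>\<close> is the ratio of the distance \<open>2 * \<delta>\<close> in the
    weight to the length \<open>\<kappa> * \<delta> / 8\<close> in the cap bound.\<close>
  define C where "C = 2 * (16 / \<kappa>) powr \<alpha> / (\<rho> - r) powr \<alpha>"
  have \<alpha>: "0 < \<alpha>" using q by (simp add: \<alpha>_def)
  have \<rho>: "r < \<rho>" "\<rho> < 1" "0 < \<rho>" using r by (auto simp: \<rho>_def)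
  have "1 \<le> 2 powr \<alpha>" using \<alpha> by (intro ge_one_powr_ge_zero) auto
  then have \<kappa>: "0 < \<kappa>" "\<kappa> \<le> 1 / 4" by (auto simp: \<kappa>_def field_simps)
  have C: "0 < C" using \<rho> \<kappa> by (simp add: C_def)
  show ?thesis
  proof (rule that[OF C])
    fix h :: "complex ^ 'n \<Rightarrow> complex" and N and z :: "complex ^ 'n"
    assume h: "holomorphic_several_on h (ball 0 1)"
      and N: "\<And>s. 0 \<le> s \<Longrightarrow> s < 1 \<Longrightarrow> hardy_mean q h s \<le> N" and z: "z \<in> cball 0 r"
    have conth: "continuous_on (ball 0 1) h"
      by (rule holomorphic_several_on_imp_continuous_on[OF h])
    define W where "W = (\<lambda>x. (\<rho> - norm x) powr \<alpha> * norm (h x))"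
    have "continuous_on (cball 0 \<rho>) W"
      unfolding W_def using \<alpha> \<rho>
      by (intro continuous_on_mult continuous_on_powr' continuous_intros continuous_on_norm
          continuous_on_subset[OF conth]) auto
    then obtain y where y: "y \<in> cball 0 \<rho>" "\<And>x. x \<in> cball 0 \<rho> \<Longrightarrow> W x \<le> W y"
      using continuous_attains_sup[of "cball 0 \<rho>" W] \<rho> by auto
    have N0: "0 \<le> N" using N[of 0] hardy_mean_nonneg[of q h 0] by simp
    have "(\<rho> - r) powr \<alpha> * norm (h z) \<le> W z"
      unfolding W_def using z \<rho> \<alpha> by (intro mult_right_mono powr_mono2) auto
    also have "\<dots> \<le> W y" using z \<rho> by (intro y) auto
    also have "W y \<le> 2 * (16 / \<kappa>) powr \<alpha> * N"
    proof (cases "W y = 0")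
      case True
      then show ?thesis using N0 by simp
    next
      case False
      define \<delta> where "\<delta> = (\<rho> - norm y) / 2"
      have hy: "h y \<noteq> 0" and "norm y \<noteq> \<rho>" using False by (auto simp: W_def)
      then have "norm y < \<rho>" using y(1) by simp
      then have "0 < \<delta>" by (simp add: \<delta>_def)
      moreover have "\<rho> - norm y < 2" using \<rho>(2) norm_ge_zero[of y] by linarith
      then have "\<delta> < 1" by (simp add: \<delta>_def)
      ultimately have \<delta>: "0 < \<delta>" "\<delta> < 1" .
      have \<delta>2: "\<rho> - norm y = 2 * \<delta>" by (simp add: \<delta>_def)
      have y1: "norm y < 1" using y(1) \<rho> by simp
      define M where "M = 2 powr \<alpha> * norm (h y)"
      \<comment> \<open>Moving by at most \<open>\<delta>\<close> leaves at least half the distance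
        to the sphere of radius \<open>\<rho>\<close>; by maximality of \<open>W y\<close> this
        costs at most the factor \<open>2 powr \<alpha>\<close>.\<close>
      have near: "w \<in> cball 0 \<rho> \<and> norm (h w) \<le> M" if "w \<in> cball y \<delta>" for w
      proof
        have "norm w \<le> norm y + \<delta>"
          using that norm_triangle_ineq[of y "w - y"] by (simp add: dist_norm norm_minus_commute)
        then have w: "norm w \<le> \<rho>" "\<delta> \<le> \<rho> - norm w" using \<delta> by (auto simp: \<delta>_def field_simps)
        then show "w \<in> cball 0 \<rho>" by simp
        have "\<delta> powr \<alpha> * norm (h w) \<le> W w"
          unfolding W_def using w \<delta> \<alpha> by (intro mult_right_mono powr_mono2) auto
        also have "\<dots> \<le> W y" using w by (intro y) auto
        also have "\<dots> = (2 * \<delta>) powr \<alpha> * norm (h y)" unfolding W_def \<delta>2 ..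
        also have "\<dots> = \<delta> powr \<alpha> * M" by (simp add: powr_mult M_def)
        finally show "norm (h w) \<le> M" using \<delta> by simp
      qed
      have half: "norm (h y) / 2 \<le> norm (h x)" if x: "norm (x - y) < 2 * (\<kappa> * \<delta> / 2)" for x
      proof -
        have "\<kappa> * \<delta> \<le> 1 / 4 * \<delta>" using \<kappa> \<delta> by (intro mult_right_mono) auto
        then have "norm (x - y) \<le> \<delta> / 2" using x \<delta> by linarith
        moreover have "cball y \<delta> \<subseteq> ball 0 1"
        proof
          fix w assume "w \<in> cball y \<delta>"
          then show "w \<in> ball 0 1" using near[of w] \<rho> by simp
        qed
        ultimately have "norm (h x - h y) \<le> 2 * M / \<delta> * norm (x - y)"
          using near \<delta> by (intro norm_diff_le_of_bounded[OF h]) auto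
        also have "\<dots> \<le> 2 * M / \<delta> * (\<kappa> * \<delta>)"
          using x \<delta> by (intro mult_left_mono) (auto simp: M_def)
        also have "\<dots> = norm (h y) / 2"
          using \<delta> by (simp add: M_def \<kappa>_def)
        finally show ?thesis
          using norm_triangle_ineq2[of "h y" "h x"] by (simp add: norm_minus_commute)
      qed
      have "norm (h y) / 2 * (\<kappa> * \<delta> / 2 / 4) powr \<alpha> \<le> hardy_mean q h (norm y)"
        unfolding \<alpha>_def
      proof (rule hardy_mean_ge_of_lower_bound[OF conth y1 q])
        have "\<kappa> * \<delta> \<le> 1 * 1" using \<kappa> \<delta> by (intro mult_mono) auto
        then show "\<kappa> * \<delta> / 2 \<le> 1" by simp
      qed (use \<kappa> \<delta> half in auto)
      also have "\<dots> \<le> N" using y1 by (intro N) auto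
      finally have le: "norm (h y) / 2 * (\<kappa> * \<delta> / 8) powr \<alpha> \<le> N" by simp
      have "W y = (2 * \<delta>) powr \<alpha> * norm (h y)" unfolding W_def \<delta>2 ..
      also have "2 * \<delta> = (16 / \<kappa>) * (\<kappa> * \<delta> / 8)" using \<kappa> by simp
      also have "((16 / \<kappa>) * (\<kappa> * \<delta> / 8)) powr \<alpha> * norm (h y)
          = 2 * (16 / \<kappa>) powr \<alpha> * (norm (h y) / 2 * (\<kappa> * \<delta> / 8) powr \<alpha>)"
        by (subst powr_mult) simp
      also have "\<dots> \<le> 2 * (16 / \<kappa>) powr \<alpha> * N"
        using le by (intro mult_left_mono) auto
      finally show ?thesis .
    qed
    finally show "norm (h z) \<le> C * N"
      using \<rho> by (simp add: C_def field_simps)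
  qed
qed

subsection \<open>The Hardy space\<close>

lemma ball_holomorphicD:
  assumes "f \<in> ball_holomorphic"
  shows "holomorphic_several_on f (ball 0 1)" "continuous_on (ball 0 1) f"
    "z \<notin> ball 0 1 \<Longrightarrow> f z = 0"
  using assms holomorphic_several_on_imp_continuous_on by (auto simp: ball_holomorphic_def)

lemma ball_holomorphic_add:
  "f \<in> ball_holomorphic \<Longrightarrow> h \<in> ball_holomorphic \<Longrightarrow> (\<lambda>x. f x + h x) \<in> ball_holomorphic"
  by (auto simp: ball_holomorphic_def intro: holomorphic_several_on_add)

lemma ball_holomorphic_cmult:
  "f \<in> ball_holomorphic \<Longrightarrow> (\<lambda>x. c * f x) \<in> ball_holomorphic"
  by (auto simp: ball_holomorphic_def intro: holomorphic_several_on_cmult)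

lemma ball_holomorphic_diff:
  "f \<in> ball_holomorphic \<Longrightarrow> h \<in> ball_holomorphic \<Longrightarrow> (\<lambda>x. f x - h x) \<in> ball_holomorphic"
  by (auto simp: ball_holomorphic_def intro: holomorphic_several_on_diff)

lemma hardy_spaceI:
  assumes "f \<in> ball_holomorphic" "\<And>s. 0 \<le> s \<Longrightarrow> s < 1 \<Longrightarrow> hardy_mean q f s \<le> B"
  shows "f \<in> hardy_space q"
  using assms by (auto simp: hardy_space_def bdd_above_def intro!: exI[of _ B])

lemma hardy_mean_le_norm:
  assumes "f \<in> hardy_space q" "0 \<le> s" "s < 1"
  shows "hardy_mean q f s \<le> hardy_norm q f"
  using assms unfolding hardy_space_def hardy_norm_def by (auto intro!: cSUP_upper)

lemma hardy_norm_leI: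
  assumes "\<And>s. 0 \<le> s \<Longrightarrow> s < 1 \<Longrightarrow> hardy_mean q f s \<le> B"
  shows "hardy_norm q f \<le> B"
  unfolding hardy_norm_def using assms by (intro cSUP_least) auto

lemma hardy_norm_nonneg: "f \<in> hardy_space q \<Longrightarrow> 0 \<le> hardy_norm q f"
  using hardy_mean_le_norm[of f q 0] hardy_mean_nonneg[of q f 0] by simp

lemma hardy_space_cmult:
  assumes "0 < q" "f \<in> hardy_space q"
  shows "(\<lambda>x. c * f x) \<in> hardy_space q"
proof (rule hardy_spaceI)
  show "(\<lambda>x. c * f x) \<in> ball_holomorphic"
    using assms by (intro ball_holomorphic_cmult) (simp add: hardy_space_def)
  show "hardy_mean q (\<lambda>x. c * f x) s \<le> norm c * hardy_norm q f" if "0 \<le> s" "s < 1" for s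
    using assms that by (simp add: hardy_mean_cmult hardy_mean_le_norm mult_left_mono)
qed

lemma hardy_norm_cmult:
  assumes q: "0 < q" and f: "f \<in> hardy_space q"
  shows "hardy_norm q (\<lambda>x. c * f x) = norm c * hardy_norm q f"
proof (rule antisym)
  show le: "hardy_norm q (\<lambda>x. c * f x) \<le> norm c * hardy_norm q f"
    using assms by (intro hardy_norm_leI) (simp add: hardy_mean_cmult hardy_mean_le_norm mult_left_mono)
  show "norm c * hardy_norm q f \<le> hardy_norm q (\<lambda>x. c * f x)"
  proof (cases "c = 0")
    case True
    then show ?thesis
      using hardy_norm_nonneg[OF hardy_space_cmult[OF assms, of c]] by simp
  next
    case False
    have "hardy_norm q f \<le> hardy_norm q (\<lambda>x. c * f x) / norm c"
    proof (rule hardy_norm_leI)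
      fix s :: real assume "0 \<le> s" "s < 1"
      then show "hardy_mean q f s \<le> hardy_norm q (\<lambda>x. c * f x) / norm c"
        using hardy_mean_le_norm[OF hardy_space_cmult[OF assms, of c], of s] False
        by (simp add: hardy_mean_cmult[OF q] field_simps)
    qed
    then show ?thesis using False by (simp add: field_simps)
  qed
qed

text \<open>The constant is left open so that the same passage to the supremum serves the
  quasi-triangle inequality and, with \<open>K = 1\<close>, Minkowski's inequality.\<close>

lemma hardy_triangle:
  fixes f h :: "complex ^ 'n::finite \<Rightarrow> complex"
  assumes q: "0 < q" and f: "f \<in> hardy_space q" and h: "h \<in> hardy_space q" and K: "0 \<le> K"
    and tri: "\<And>s. 0 \<le> s \<Longrightarrow> s < 1 \<Longrightarrow>
      hardy_mean q (\<lambda>x. f x + h x) s \<le> K * (hardy_mean q f s + hardy_mean q h s)"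
  shows "(\<lambda>x. f x + h x) \<in> hardy_space q"
    and "hardy_norm q (\<lambda>x. f x + h x) \<le> K * (hardy_norm q f + hardy_norm q h)"
proof -
  have le: "hardy_mean q (\<lambda>x. f x + h x) s \<le> K * (hardy_norm q f + hardy_norm q h)"
    if "0 \<le> s" "s < 1" for s
    by (rule order_trans[OF tri[OF that]])
       (intro mult_left_mono add_mono hardy_mean_le_norm f h that K)
  show "(\<lambda>x. f x + h x) \<in> hardy_space q"
    using f h by (intro hardy_spaceI[OF ball_holomorphic_add le]) (auto simp: hardy_space_def)
  show "hardy_norm q (\<lambda>x. f x + h x) \<le> K * (hardy_norm q f + hardy_norm q h)"
    by (rule hardy_norm_leI[OF le])
qed

lemma hardy_space_holomorphic: "f \<in> hardy_space q \<Longrightarrow> f \<in> ball_holomorphic"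
  by (simp add: hardy_space_def)

lemma hardy_space_add:
  assumes "0 < q" "f \<in> hardy_space q" "h \<in> hardy_space q"
  shows "(\<lambda>x. f x + h x) \<in> hardy_space q"
  using assms by (intro hardy_triangle(1)[OF assms, of "2 powr (1 + 1 / q)"] hardy_mean_add_quasi)
    (auto intro: ball_holomorphicD(2) hardy_space_holomorphic)

lemma hardy_norm_add_quasi:
  assumes "0 < q" "f \<in> hardy_space q" "h \<in> hardy_space q"
  shows "hardy_norm q (\<lambda>x. f x + h x) \<le> 2 powr (1 + 1 / q) * (hardy_norm q f + hardy_norm q h)"
  using assms by (intro hardy_triangle(2)[OF assms] hardy_mean_add_quasi)
    (auto intro: ball_holomorphicD(2) hardy_space_holomorphic)

lemma hardy_norm_add:
  assumes "1 \<le> q" "f \<in> hardy_space q" "h \<in> hardy_space q"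
  shows "hardy_norm q (\<lambda>x. f x + h x) \<le> hardy_norm q f + hardy_norm q h"
  using hardy_triangle(2)[of q f h 1] hardy_mean_add[of f h _ q] assms
  by (auto dest!: hardy_space_holomorphic simp: ball_holomorphicD(2))

lemma hardy_space_pointwise_bound:
  assumes "0 < q" "0 \<le> r" "r < 1"
  obtains C where "0 < C"
    "\<And>h z. (h :: complex ^ 'n::finite \<Rightarrow> complex) \<in> hardy_space q \<Longrightarrow> z \<in> cball 0 r \<Longrightarrow>
       norm (h z) \<le> C * hardy_norm q h"
proof -
  obtain C where C: "0 < C"
    "\<And>(h :: complex ^ 'n::finite \<Rightarrow> complex) N z. holomorphic_several_on h (ball 0 1) \<Longrightarrow>
       (\<And>s. 0 \<le> s \<Longrightarrow> s < 1 \<Longrightarrow> hardy_mean q h s \<le> N) \<Longrightarrow> z \<in> cball 0 r \<Longrightarrow> norm (h z) \<le> C * N"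
    using hardy_mean_pointwise_bound[OF assms] by blast
  show ?thesis
  proof (rule that[OF C(1)])
    fix h :: "complex ^ 'n \<Rightarrow> complex" and z :: "complex ^ 'n"
    assume "h \<in> hardy_space q" "z \<in> cball 0 r"
    then show "norm (h z) \<le> C * hardy_norm q h"
      by (intro C(2) hardy_mean_le_norm ball_holomorphicD(1) hardy_space_holomorphic)
  qed
qed

lemma ball_holomorphic_zero: "(\<lambda>x. 0) \<in> ball_holomorphic"
  by (auto simp: ball_holomorphic_def holomorphic_several_on_def intro!: exI[of _ "\<lambda>v. 0"])

lemma hardy_mean_zero: "hardy_mean q (\<lambda>x. 0) s = 0"
  by (simp add: hardy_mean_def)

lemma hardy_norm_zero: "hardy_norm q (\<lambda>x. 0) = 0"
  by (simp add: hardy_norm_def hardy_mean_zero)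

subsection \<open>The optimal domain\<close>

lemma volterra_zero: "volterra g (\<lambda>x. 0) = (\<lambda>x. 0)"
  using volterra_cmult[of g 0 "\<lambda>x. 0"] by simp

lemma volterra_at_0: "volterra g f 0 = 0"
  by (simp add: volterra_def radial_deriv_def)

lemma optimal_domainD:
  assumes "f \<in> optimal_domain g q"
  shows "f \<in> ball_holomorphic" "holomorphic_several_on f (ball 0 1)" "volterra g f \<in> hardy_space q"
  using assms by (auto simp: optimal_domain_def ball_holomorphicD)

context
  fixes g :: "complex ^ 'n::finite \<Rightarrow> complex" and q :: real
  assumes q: "0 < q" and g: "holomorphic_several_on g (ball 0 1)"
begin

lemma function_subspace_optimal_domain: "function_subspace (optimal_domain g q)"
  unfolding function_subspace_def
proof (intro conjI ballI allI)
  have "(\<lambda>x. 0 :: complex) \<in> hardy_space q"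
    by (rule hardy_spaceI[OF ball_holomorphic_zero, of q 0]) (simp add: hardy_mean_zero)
  then show "(\<lambda>x. 0) \<in> optimal_domain g q"
    by (simp add: optimal_domain_def ball_holomorphic_zero volterra_zero)
next
  fix f h assume f: "f \<in> optimal_domain g q" and h: "h \<in> optimal_domain g q"
  then show "(\<lambda>x. f x + h x) \<in> optimal_domain g q"
    using volterra_add[OF g optimal_domainD(2)[OF f] optimal_domainD(2)[OF h]]
    by (auto simp: optimal_domain_def ball_holomorphic_add hardy_space_add[OF q])
next
  fix c f assume f: "f \<in> optimal_domain g q"
  then show "(\<lambda>x. c * f x) \<in> optimal_domain g q"
    by (auto simp: optimal_domain_def ball_holomorphic_cmult hardy_space_cmult[OF q] volterra_cmult)
qed

lemma optimal_norm_diff: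
  assumes "f \<in> optimal_domain g q" "h \<in> optimal_domain g q"
  shows "optimal_norm g q (\<lambda>x. f x - h x) = hardy_norm q (\<lambda>x. volterra g f x - volterra g h x)"
  unfolding optimal_norm_def
  using volterra_diff[OF g optimal_domainD(2)[OF assms(1)] optimal_domainD(2)[OF assms(2)]] by simp

context
  assumes nc: "\<not> g constant_on ball 0 1"
begin

lemma optimal_norm_eq_0_imp_zero:
  assumes f: "f \<in> optimal_domain g q" and N: "optimal_norm g q f = 0"
  shows "f = (\<lambda>x. 0)"
proof
  fix z
  show "f z = 0"
  proof (cases "z \<in> ball 0 1")
    case True
    have T0: "volterra g f = (\<lambda>x. 0)"
    proof
      fix w :: "complex ^ 'n"
      show "volterra g f w = 0"
      proof (cases "w \<in> ball 0 1")
        case True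
        then have "norm w < 1" by simp
        then obtain C where "\<And>h z. (h :: complex ^ 'n \<Rightarrow> complex) \<in> hardy_space q \<Longrightarrow>
            z \<in> cball 0 (norm w) \<Longrightarrow> norm (h z) \<le> C * hardy_norm q h"
          using hardy_space_pointwise_bound[OF q norm_ge_zero] by metis
        from this[OF optimal_domainD(3)[OF f], of w] N show ?thesis
          by (simp add: optimal_norm_def)
      qed (simp add: volterra_def)
    qed
    have z: "f w * radial_deriv g w = 0" if "w \<in> ball 0 1" for w
    proof -
      have "radial_deriv (volterra g f) w = f w * radial_deriv g w"
        by (rule radial_deriv_volterra[OF optimal_domainD(2)[OF f] g _ that])
           (use optimal_domainD(3)[OF f] hardy_space_holomorphic ball_holomorphicD(1) in blast)
      then show ?thesis
        by (simp add: T0 radial_deriv_def partial_deriv_def)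
    qed
    obtain p where p: "p \<in> ball 0 1" "radial_deriv g p \<noteq> 0"
      using radial_deriv_nonzero_exists[OF g nc] by blast
    obtain e C R where *: "0 < e" "0 < C" "R < 1"
      "\<And>f B w. holomorphic_several_on f (ball 0 1) \<Longrightarrow>
       (\<And>w. w \<in> cball 0 R \<Longrightarrow> norm (f w * radial_deriv g w) \<le> B) \<Longrightarrow> w \<in> cball z e \<Longrightarrow> norm (f w) \<le> C * B"
      using local_division_bound[OF holomorphic_radial_deriv[OF g] p True] by metis
    \<comment> \<open>The division bound with \<open>B = 0\<close> plays the part of an identity
      theorem: it gives \<open>f z = 0\<close> even where \<open>radial_deriv g\<close>
      vanishes.\<close>
    have "norm (f z) \<le> C * 0"
      by (rule *(4)[OF optimal_domainD(2)[OF f]]) (use z * in auto)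
    then show ?thesis by simp
  next
    case False
    then show ?thesis using optimal_domainD(1)[OF f] ball_holomorphicD(3) by blast
  qed
qed

text \<open>Linearity of \<open>volterra g\<close> carries homogeneity and the triangle inequality
  over from the Hardy space with the same constant; definiteness is the part that uses that
  \<open>g\<close> is not constant.\<close>

lemma quasinorm_optimal_normI:
  assumes tri: "\<And>f h. f \<in> hardy_space q \<Longrightarrow> h \<in> hardy_space q \<Longrightarrow>
    hardy_norm q (\<lambda>x. f x + h x) \<le> K * (hardy_norm q f + hardy_norm q (h :: complex ^ 'n \<Rightarrow> complex))"
  shows "quasinorm_with_constant K (optimal_domain g q) (optimal_norm g q)"
  unfolding quasinorm_with_constant_def
proof (intro conjI ballI allI)
  fix f assume f: "f \<in> optimal_domain g q"
  show "0 \<le> optimal_norm g q f"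
    unfolding optimal_norm_def by (rule hardy_norm_nonneg[OF optimal_domainD(3)[OF f]])
  show "optimal_norm g q f = 0 \<longleftrightarrow> f = (\<lambda>x. 0)"
    using optimal_norm_eq_0_imp_zero[OF f] by (auto simp: optimal_norm_def volterra_zero hardy_norm_zero)
  show "optimal_norm g q (\<lambda>x. c * f x) = norm c * optimal_norm g q f" for c
    unfolding optimal_norm_def volterra_cmult by (rule hardy_norm_cmult[OF q optimal_domainD(3)[OF f]])
  fix h assume h: "h \<in> optimal_domain g q"
  show "optimal_norm g q (\<lambda>x. f x + h x) \<le> K * (optimal_norm g q f + optimal_norm g q h)"
    unfolding optimal_norm_def volterra_add[OF g optimal_domainD(2)[OF f] optimal_domainD(2)[OF h]]
    by (rule tri[OF optimal_domainD(3)[OF f] optimal_domainD(3)[OF h]])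
qed

text \<open>
  If \<open>F\<close> is Cauchy for the optimal norm, \<open>T\<^sub>g F\<close> converges locally uniformly to some \<open>h\<close>, and so does
  its radial derivative \<open>F * radial_deriv g\<close>; dividing by \<open>radial_deriv g\<close> gives a locally uniform limit
  \<open>f\<close> of \<open>F\<close>, and \<open>h\<close> is recovered from \<open>f\<close> by integrating along rays.
\<close>

lemma optimal_domain_complete: "quasinormed_complete (optimal_domain g q) (optimal_norm g q)"
  unfolding quasinormed_complete_def
proof (intro allI impI, elim conjE)
  fix F :: "nat \<Rightarrow> complex ^ 'n \<Rightarrow> complex"
  assume F: "\<forall>k. F k \<in> optimal_domain g q"
    and cau: "\<forall>e>0. \<exists>M. \<forall>m\<ge>M. \<forall>n\<ge>M. optimal_norm g q (\<lambda>x. F m x - F n x) < e"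
  define T where "T = (\<lambda>k. volterra g (F k))"
  have hF: "holomorphic_several_on (F k) (ball 0 1)" for k
    using F optimal_domainD(2) by blast
  have TH: "T k \<in> hardy_space q" for k
    using F optimal_domainD(3) by (auto simp: T_def)
  have Tb: "T k \<in> ball_holomorphic" for k
    using TH hardy_space_holomorphic by blast
  have hT: "holomorphic_several_on (T k) (ball 0 1)" for k
    by (rule ball_holomorphicD(1)[OF Tb])
  have Tdiff: "(\<lambda>x. T m x - T n x) \<in> hardy_space q" for m n
    using hardy_space_add[OF q TH[of m] hardy_space_cmult[OF q TH[of n], of "-1"]] by simp
  have cauT: "\<exists>M. \<forall>m\<ge>M. \<forall>n\<ge>M. hardy_norm q (\<lambda>x. T m x - T n x) < e" if "0 < e" for e
    using cau that F optimal_norm_diff by (simp add: T_def)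
  have cauT_pt: "\<exists>M. \<forall>m\<ge>M. \<forall>n\<ge>M. \<forall>z\<in>cball 0 r. norm (T m z - T n z) < e"
    if r: "0 \<le> r" "r < 1" and e: "0 < e" for r e
  proof -
    obtain C where C: "0 < C" "\<And>h z. (h :: complex ^ 'n \<Rightarrow> complex) \<in> hardy_space q \<Longrightarrow>
        z \<in> cball 0 r \<Longrightarrow> norm (h z) \<le> C * hardy_norm q h"
      using hardy_space_pointwise_bound[OF q r] by blast
    obtain M where M: "\<And>m n. m \<ge> M \<Longrightarrow> n \<ge> M \<Longrightarrow> hardy_norm q (\<lambda>x. T m x - T n x) < e / C"
      using cauT[of "e / C"] e C(1) by auto
    have "norm (T m z - T n z) < e" if "m \<ge> M" "n \<ge> M" "z \<in> cball 0 r" for m n z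
    proof -
      have "norm (T m z - T n z) \<le> C * hardy_norm q (\<lambda>x. T m x - T n x)"
        using C(2)[OF Tdiff that(3)] .
      also have "\<dots> < C * (e / C)"
        using M[OF that(1,2)] C(1) by (intro mult_strict_left_mono)
      finally show ?thesis using C(1) by simp
    qed
    then show ?thesis by blast
  qed
  define h where "h = (\<lambda>z. lim (\<lambda>k. T k z))"
  have ulT: "uniform_limit (cball 0 r) T h sequentially" if "0 \<le> r" "r < 1" for r
  proof -
    have "uniformly_Cauchy_on (cball 0 r) T"
      using cauT_pt[OF that] unfolding uniformly_Cauchy_on_def dist_norm by meson
    then show ?thesis
      unfolding h_def uniformly_convergent_uniform_limit_iff[symmetric]
      by (rule Cauchy_uniformly_convergent)
  qed
  have limT: "(\<lambda>k. T k z) \<longlonglongrightarrow> h z" if "z \<in> ball 0 1" for z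
    using tendsto_uniform_limitI[OF ulT[of "norm z"], of z] that by simp
  have hb: "h \<in> ball_holomorphic"
    unfolding ball_holomorphic_def
  proof (intro CollectI conjI allI impI)
    show "holomorphic_several_on h (ball 0 1)"
    proof (rule holomorphic_several_on_local)
      fix z :: "complex ^ 'n" assume "z \<in> ball 0 1"
      then obtain r where r: "norm z < r" "r < 1"
        using dense[of "norm z" 1] by auto
      then have r0: "0 \<le> r" using norm_ge_zero[of z] by linarith
      have "holomorphic_several_on h (ball 0 r)"
      proof (rule holomorphic_several_on_uniform_limit[of _ T])
        show "uniform_limit (ball 0 r) T h sequentially"
          using ulT[OF r0 r(2)] by (rule uniform_limit_on_subset) auto
        show "holomorphic_several_on (T k) (ball 0 r)" for k
          using hT by (rule holomorphic_several_on_subset) (use r in auto)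
      qed simp
      then show "\<exists>S. z \<in> S \<and> holomorphic_several_on h S"
        using r by (intro exI[of _ "ball 0 r"]) simp
    qed
    fix z :: "complex ^ 'n" assume "z \<notin> ball 0 1"
    then have "T k z = 0" for k using ball_holomorphicD(3)[OF Tb] by blast
    then show "h z = 0" by (simp add: h_def)
  qed
  obtain p where p: "p \<in> ball 0 1" "radial_deriv g p \<noteq> 0"
    using radial_deriv_nonzero_exists[OF g nc] by blast
  define f where "f = (\<lambda>z. if z \<in> ball 0 1 then lim (\<lambda>k. F k z) else 0)"
  have ulF: "\<exists>e>0. cball z e \<subseteq> ball 0 1 \<and> uniform_limit (cball z e) F f sequentially"
    if z: "z \<in> ball 0 1" for z
  proof -
    obtain e C R where *: "0 < e" "cball z e \<subseteq> ball 0 1" "0 < C" "R < 1"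
      "\<And>f B w. holomorphic_several_on f (ball 0 1) \<Longrightarrow>
       (\<And>w. w \<in> cball 0 R \<Longrightarrow> norm (f w * radial_deriv g w) \<le> B) \<Longrightarrow> w \<in> cball z e \<Longrightarrow> norm (f w) \<le> C * B"
      using local_division_bound[OF holomorphic_radial_deriv[OF g] p z] by metis
    \<comment> \<open>\<open>R\<close> comes without a sign, whereas \<open>cauT_pt\<close> asks for
      a nonnegative radius. \<open>R'\<close> then leaves a collar of width \<open>R' - r\<close>
      for Cauchy's estimate.\<close>
    define r where "r = max R 0"
    define R' where "R' = (1 + r) / 2"
    have R': "R \<le> r" "r < R'" "R' < 1" "0 \<le> R'" using *(4) by (auto simp: r_def R'_def)
    have "uniformly_Cauchy_on (cball z e) F"
      unfolding uniformly_Cauchy_on_def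
    proof (intro allI impI)
      fix \<epsilon> :: real assume \<epsilon>: "0 < \<epsilon>"
      \<comment> \<open>Cancels the loss \<open>1 / (R' - r)\<close> of the radial derivative bound
        and the loss \<open>C\<close> of the division, leaving
        \<open>\<epsilon> / 2\<close>.\<close>
      define d where "d = \<epsilon> / (2 * C) * (R' - r)"
      have d: "0 < d" using \<epsilon> * R' by (simp add: d_def)
      obtain M where M: "\<And>m n w. m \<ge> M \<Longrightarrow> n \<ge> M \<Longrightarrow> w \<in> cball 0 R' \<Longrightarrow> norm (T m w - T n w) < d"
        using cauT_pt[OF R'(4,3) d] by blast
      have "dist (F m w) (F n w) < \<epsilon>" if mn: "m \<ge> M" "n \<ge> M" and w: "w \<in> cball z e" for m n w
      proof -
        have hFd: "holomorphic_several_on (\<lambda>x. F m x - F n x) (ball 0 1)"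
          by (intro holomorphic_several_on_diff hF)
        have hTd: "holomorphic_several_on (\<lambda>x. T m x - T n x) (ball 0 1)"
          by (intro holomorphic_several_on_diff hT)
        have eq: "volterra g (\<lambda>x. F m x - F n x) = (\<lambda>x. T m x - T n x)"
          unfolding T_def by (rule volterra_diff[OF g hF hF])
        have "norm ((F m x - F n x) * radial_deriv g x) \<le> d / (R' - r)" if "x \<in> cball 0 R" for x
        proof -
          have "norm x \<le> r" using that R' by simp
          have "x \<in> ball 0 1" using \<open>norm x \<le> r\<close> R' by simp
          then have "(F m x - F n x) * radial_deriv g x = radial_deriv (\<lambda>x. T m x - T n x) x"
            using radial_deriv_volterra[OF hFd g, of x] hTd by (simp add: eq)
          moreover have "norm (radial_deriv (\<lambda>x. T m x - T n x) x) \<le> d / (R' - r)"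
            by (rule radial_deriv_bound[OF hTd \<open>norm x \<le> r\<close> R'(2,3)]) (use M mn in \<open>auto intro: less_imp_le\<close>)
          ultimately show ?thesis by simp
        qed
        then have "norm (F m w - F n w) \<le> C * (d / (R' - r))"
          using *(5)[OF hFd _ w] by blast
        also have "\<dots> = \<epsilon> / 2" using *(3) R' by (simp add: d_def)
        finally show ?thesis using \<epsilon> by (simp add: dist_norm)
      qed
      then show "\<exists>M. \<forall>x\<in>cball z e. \<forall>m\<ge>M. \<forall>n\<ge>M. dist (F m x) (F n x) < \<epsilon>"
        by blast
    qed
    then have "uniformly_convergent_on (cball z e) F"
      by (rule Cauchy_uniformly_convergent)
    then have "uniform_limit (cball z e) F (\<lambda>z. lim (\<lambda>k. F k z)) sequentially"
      by (simp only: uniformly_convergent_uniform_limit_iff)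
    moreover have feq: "f x = lim (\<lambda>k. F k x)" if "x \<in> cball z e" for x
      unfolding f_def using subsetD[OF *(2) that] by (rule if_P)
    moreover have "uniform_limit (cball z e) F f sequentially \<longleftrightarrow>
        uniform_limit (cball z e) F (\<lambda>z. lim (\<lambda>k. F k z)) sequentially"
      by (rule uniform_limit_cong'[OF refl feq])
    ultimately have "uniform_limit (cball z e) F f sequentially" by blast
    then show ?thesis using *(1,2) by blast
  qed
  have fb: "f \<in> ball_holomorphic"
    unfolding ball_holomorphic_def
  proof (intro CollectI conjI allI impI)
    show "holomorphic_several_on f (ball 0 1)"
    proof (rule holomorphic_several_on_local)
      fix z :: "complex ^ 'n" assume "z \<in> ball 0 1"
      then obtain e where e: "0 < e" "cball z e \<subseteq> ball 0 1" "uniform_limit (cball z e) F f sequentially"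
        using ulF by blast
      have "holomorphic_several_on f (ball z e)"
      proof (rule holomorphic_several_on_uniform_limit[of _ F])
        show "uniform_limit (ball z e) F f sequentially"
          using e(3) ball_subset_cball by (rule uniform_limit_on_subset)
        show "holomorphic_several_on (F k) (ball z e)" for k
          using hF order_trans[OF ball_subset_cball e(2)] by (rule holomorphic_several_on_subset)
      qed simp
      then show "\<exists>S. z \<in> S \<and> holomorphic_several_on f S"
        using e(1) by (intro exI[of _ "ball z e"]) simp
    qed
  qed (simp add: f_def)
  have limF: "(\<lambda>k. F k z) \<longlonglongrightarrow> f z" if z: "z \<in> ball 0 1" for z
  proof -
    obtain e where e: "0 < e" "uniform_limit (cball z e) F f sequentially"
      using ulF[OF z] by blast
    then show ?thesis using tendsto_uniform_limitI[OF e(2), of z] by simp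
  qed
  have Tf: "volterra g f = h"
  proof
    fix z
    show "volterra g f z = h z"
    proof (cases "z \<in> ball 0 1")
      case True
      define S where "S = {l. l *s z \<in> ball 0 1}"
      have "open S" using open_slice[of "ball 0 1" 0 z] by (simp add: S_def)
      \<comment> \<open>Weierstrass' theorem on the slice: the derivatives of \<open>T k\<close>
        converge to that of \<open>h\<close>. Since they also converge to \<open>f\<close> times the
        derivative of \<open>g\<close>, \<open>h\<close> is a primitive on the ray, and
        \<open>h 0 = 0\<close> fixes the constant.\<close>
      have "\<exists>g'. \<forall>l\<in>S. ((\<lambda>l. h (l *s z)) has_field_derivative g' l) (at l) \<and>
          (\<lambda>k. F k (l *s z) * deriv (\<lambda>l. g (l *s z)) l) \<longlonglongrightarrow> g' l"
      proof (rule has_complex_derivative_uniform_sequence[OF \<open>open S\<close>, of "\<lambda>k l. T k (l *s z)"])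
        show "((\<lambda>l. T k (l *s z)) has_field_derivative F k (l *s z) * deriv (\<lambda>l. g (l *s z)) l) (at l)"
          if "l \<in> S" for k l
          unfolding T_def using has_field_derivative_volterra_ray[OF hF g] that by (simp add: S_def)
        fix l assume "l \<in> S"
        then obtain r where r: "norm (l *s z) < r" "r < 1"
          using dense[of "norm (l *s z)" 1] by (auto simp: S_def)
        have r0: "0 \<le> r" using r(1) norm_ge_zero[of "l *s z"] by linarith
        have "open {l. l *s z \<in> ball 0 r}"
          using open_slice[of "ball 0 r" 0 z] by simp
        moreover have "l \<in> {l. l *s z \<in> ball 0 r}" using r by simp
        ultimately obtain d where d: "0 < d" "cball l d \<subseteq> {l. l *s z \<in> ball 0 r}"
          using open_contains_cball by metis
        have "uniform_limit (cball l d) (\<lambda>k l. T k (l *s z)) (\<lambda>l. h (l *s z)) sequentially"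
          using ulT[OF r0 r(2)] by (rule uniform_limit_compose') (use d(2) in \<open>auto intro: less_imp_le\<close>)
        moreover have "cball l d \<subseteq> S"
          using d(2) r(2) unfolding S_def by (auto intro: less_trans)
        ultimately show "\<exists>d>0. cball l d \<subseteq> S \<and>
            uniform_limit (cball l d) (\<lambda>k l. T k (l *s z)) (\<lambda>l. h (l *s z)) sequentially"
          using d(1) by blast
      qed
      then obtain g' where g': "\<And>l. l \<in> S \<Longrightarrow> ((\<lambda>l. h (l *s z)) has_field_derivative g' l) (at l)"
        "\<And>l. l \<in> S \<Longrightarrow> (\<lambda>k. F k (l *s z) * deriv (\<lambda>l. g (l *s z)) l) \<longlonglongrightarrow> g' l"
        by blast
      have "((\<lambda>l. h (l *s z)) has_field_derivative f (l *s z) * deriv (\<lambda>l. g (l *s z)) l) (at l)"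
        if l: "l *s z \<in> ball 0 1" for l
      proof -
        have "l \<in> S" using l by (simp add: S_def)
        moreover have "(\<lambda>k. F k (l *s z) * deriv (\<lambda>l. g (l *s z)) l)
            \<longlonglongrightarrow> f (l *s z) * deriv (\<lambda>l. g (l *s z)) l"
          by (intro tendsto_mult tendsto_const limF l)
        ultimately have "g' l = f (l *s z) * deriv (\<lambda>l. g (l *s z)) l"
          using g'(2) LIMSEQ_unique by blast
        then show ?thesis using g'(1)[OF \<open>l \<in> S\<close>] by simp
      qed
      then have "volterra g f (1 *s z) = h (1 *s z) - h (0 *s z)"
        by (rule volterra_ray_eq[OF g]) (use True in auto)
      moreover have "h 0 = 0"
        by (simp add: h_def T_def volterra_at_0)
      ultimately show ?thesis by simp
    next
      case False
      then show ?thesis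
        using ball_holomorphicD(3)[OF hb] by (simp add: volterra_def)
    qed
  qed
  define K where "K = 2 powr (1 + 1 / q)"
  have K: "0 < K" by (simp add: K_def)
  \<comment> \<open>The index \<open>M\<close> comes from the Cauchy condition in the Hardy norm and
    works for all radii. For a fixed \<open>s\<close>, an auxiliary \<open>T n\<close> uniformly
    close to \<open>h\<close> on \<open>cball 0 s\<close> is inserted; \<open>n\<close> may depend
    on \<open>s\<close> and \<open>\<epsilon>\<close>, as it disappears from the conclusion.\<close>
  have mean: "\<exists>M. \<forall>m\<ge>M. \<forall>s. 0 \<le> s \<and> s < 1 \<longrightarrow> hardy_mean q (\<lambda>x. T m x - h x) s \<le> K * e"
    if e: "0 < e" for e
  proof -
    obtain M where M: "\<And>m n. m \<ge> M \<Longrightarrow> n \<ge> M \<Longrightarrow> hardy_norm q (\<lambda>x. T m x - T n x) < e"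
      using cauT[OF e] by blast
    have "hardy_mean q (\<lambda>x. T m x - h x) s \<le> K * e" if m: "m \<ge> M" and s: "0 \<le> s" "s < 1" for m s
    proof (rule field_le_epsilon)
      fix \<epsilon> :: real assume \<epsilon>: "0 < \<epsilon>"
      have "\<forall>\<^sub>F n in sequentially. n \<ge> M \<and> (\<forall>x\<in>cball 0 s. dist (T n x) (h x) < \<epsilon> / K)"
        using uniform_limitD[OF ulT[OF s], of "\<epsilon> / K"] \<epsilon> K
        by (intro eventually_conj eventually_ge_at_top) simp
      then obtain n where n: "n \<ge> M" "\<And>x. x \<in> cball 0 s \<Longrightarrow> dist (T n x) (h x) < \<epsilon> / K"
        by (auto dest!: eventually_happens)
      have b: "(\<lambda>x. T n x - h x) \<in> ball_holomorphic"
        by (intro ball_holomorphic_diff Tb hb)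
      have "hardy_mean q (\<lambda>x. T m x - h x) s = hardy_mean q (\<lambda>x. (T m x - T n x) + (T n x - h x)) s"
        by simp
      also have "\<dots> \<le> K * (hardy_mean q (\<lambda>x. T m x - T n x) s + hardy_mean q (\<lambda>x. T n x - h x) s)"
        unfolding K_def
        by (intro hardy_mean_add_quasi s q ball_holomorphicD(2)[OF b]
            ball_holomorphicD(2)[OF hardy_space_holomorphic[OF Tdiff]])
      also have "\<dots> \<le> K * (e + \<epsilon> / K)"
      proof (intro mult_left_mono add_mono)
        show "hardy_mean q (\<lambda>x. T m x - T n x) s \<le> e"
          using hardy_mean_le_norm[OF Tdiff s, of m n] M[OF m n(1)] by linarith
        show "hardy_mean q (\<lambda>x. T n x - h x) s \<le> \<epsilon> / K"
          using n(2) \<epsilon> K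
          by (intro hardy_mean_le_bound[OF ball_holomorphicD(2)[OF b] s q]) (auto simp: dist_norm intro: less_imp_le)
      qed (use K in simp)
      also have "\<dots> = K * e + \<epsilon>" using K by (simp add: field_simps)
      finally show "hardy_mean q (\<lambda>x. T m x - h x) s \<le> K * e + \<epsilon>" .
    qed
    then show ?thesis by blast
  qed
  obtain m where m: "\<And>s. 0 \<le> s \<Longrightarrow> s < 1 \<Longrightarrow> hardy_mean q (\<lambda>x. T m x - h x) s \<le> K * 1"
    using mean[of 1] by auto
  \<comment> \<open>One difference with bounded means is enough: \<open>h\<close> is
    \<open>T m\<close> minus this difference.\<close>
  have "(\<lambda>x. T m x - h x) \<in> hardy_space q"
    by (rule hardy_spaceI[OF ball_holomorphic_diff[OF Tb hb] m])
  from hardy_space_add[OF q TH[of m] hardy_space_cmult[OF q this, of "-1"]]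
  have "h \<in> hardy_space q" by simp
  then have fV: "f \<in> optimal_domain g q"
    by (simp add: optimal_domain_def fb Tf)
  have eq: "optimal_norm g q (\<lambda>x. F k x - f x) = hardy_norm q (\<lambda>x. T k x - h x)" for k
    using optimal_norm_diff[OF spec[OF F, of k] fV] by (simp add: Tf T_def)
  have "(\<lambda>x. T k x - h x) \<in> hardy_space q" for k
    using hardy_space_add[OF q TH[of k] hardy_space_cmult[OF q \<open>h \<in> hardy_space q\<close>, of "-1"]] by simp
  then have nonneg: "0 \<le> hardy_norm q (\<lambda>x. T k x - h x)" for k
    by (rule hardy_norm_nonneg)
  have "(\<lambda>k. hardy_norm q (\<lambda>x. T k x - h x)) \<longlonglongrightarrow> 0"
  proof (rule LIMSEQ_I)
    fix e :: real assume e: "0 < e"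
    then obtain M where M: "\<And>k s. k \<ge> M \<Longrightarrow> 0 \<le> s \<Longrightarrow> s < 1 \<Longrightarrow>
        hardy_mean q (\<lambda>x. T k x - h x) s \<le> K * (e / (2 * K))"
      using mean[of "e / (2 * K)"] K by auto
    have "hardy_norm q (\<lambda>x. T k x - h x) < e" if "k \<ge> M" for k
    proof -
      have "hardy_norm q (\<lambda>x. T k x - h x) \<le> K * (e / (2 * K))"
        by (rule hardy_norm_leI[OF M[OF that]])
      also have "\<dots> < e" using e K by simp
      finally show ?thesis .
    qed
    then show "\<exists>M. \<forall>k\<ge>M. norm (hardy_norm q (\<lambda>x. T k x - h x) - 0) < e"
      using nonneg by (intro exI[of _ M]) simp
  qed
  then have "(\<lambda>k. optimal_norm g q (\<lambda>x. F k x - f x)) \<longlonglongrightarrow> 0"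
    by (simp only: eq)
  then show "\<exists>f\<in>optimal_domain g q. (\<lambda>k. optimal_norm g q (\<lambda>x. F k x - f x)) \<longlonglongrightarrow> 0"
    using fV by (rule bexI)
qed

end

end

theorem theorem1:
  fixes g :: "complex ^ 'n::finite \<Rightarrow> complex" and q :: real
  assumes "0 < q"
    and "holomorphic_several_on g (ball 0 1)"
    and "\<not> g constant_on ball 0 1"
  shows "quasi_banach_space (optimal_domain g q) (optimal_norm g q) \<and>
         (1 \<le> q \<longrightarrow> banach_space (optimal_domain g q) (optimal_norm g q))"
proof (intro conjI impI)
  note complete = function_subspace_optimal_domain[OF assms(1,2)] optimal_domain_complete[OF assms]
  have "quasinorm_with_constant (2 powr (1 + 1 / q)) (optimal_domain g q) (optimal_norm g q)"
    by (intro quasinorm_optimal_normI assms hardy_norm_add_quasi)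
  moreover have "(1 :: real) \<le> 2 powr (1 + 1 / q)"
    using assms(1) by (intro ge_one_powr_ge_zero) auto
  ultimately show "quasi_banach_space (optimal_domain g q) (optimal_norm g q)"
    using complete by (auto simp: quasi_banach_space_def)
  assume "1 \<le> q"
  then have "quasinorm_with_constant 1 (optimal_domain g q) (optimal_norm g q)"
    using assms by (intro quasinorm_optimal_normI) (simp_all add: hardy_norm_add)
  then show "banach_space (optimal_domain g q) (optimal_norm g q)"
    using complete by (simp add: banach_space_def)
qed

end
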